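(* For every $n<\omega$, there exists a computable connected graph $G$ whose distance function $d_G$ is intrinsically $2n$-approximable from above and such that, for every total function $f:\omega\to\omega$ which is $n$-approximable from above, there is some computable graph $H\cong G$ whose distance function $d_H$ satisfies $d_H\le_{2\text{-btt}} f\le_{1\text{-btt}} d_H$.
   Context: A graph is computable if its domain is $\omega$ or a finite initial segment of $\omega$ and its (symmetric, irreflexive) edge relation is computable. The distance function of a connected graph gives the length of the shortest path between nodes, regarded as a function on $\omega$ via a fixed computable pairing. A total $h:\omega\to\omega$ is $k$-approximable from above if there is a total computable $g$ with $h(x)=\lim_s g(x,s)$, $g(x,s+1)\le g(x,s)$ for all $x,s$, and $|\{s: g(x,s)\ne g(x,s+1)\}|\le k$ for all $x$. The distance function of $G$ is intrinsically $k$-approximable from above if for every computable graph $H\cong G$ the distance function of $H$ is $k$-approximable from above. For total $\alpha,\beta$, with $D_e$ the finite set of canonical index $e$: $\alpha\le_{k\text{-btt}}\beta$ if there are total computable $p,q$ with $|D_{p(x)}|\le k$ and $\alpha(x)=q(x,\beta\restriction D_{p(x)})$ for all $x$. *)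

theory Defs
  imports "Graph_Theory.Digraph_Isomorphism" "HOL-Library.Nat_Bijection"
begin

section \<open>Computable functions\<close>

text \<open>
  The partial recursive functions: codes are terms, and the relation
  \<open>recf_eval e xs y\<close> says that the computation of \<open>e\<close> on input \<open>xs\<close> halts with value \<open>y\<close>.
  Arities are not recorded in the terms; where the arities do not fit, nothing is derivable,
  that is, the computation diverges. \<open>Zero\<close> is the constant function of every arity.
\<close>

datatype recf =
    Zero
  | Succ
  | Proj nat
  | Comp recf "recf list"
  | PrimRec recf recf
  | Mu recf

inductive recf_eval :: "recf \<Rightarrow> nat list \<Rightarrow> nat \<Rightarrow> bool" where
  Zero: "recf_eval Zero xs 0"
| Succ: "recf_eval Succ [x] (Suc x)"
| Proj: "i < length xs \<Longrightarrow> recf_eval (Proj i) xs (xs ! i)"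
| Comp: "list_all2 (\<lambda>g y. recf_eval g xs y) gs ys \<Longrightarrow> recf_eval f ys z
    \<Longrightarrow> recf_eval (Comp f gs) xs z"
| PrimRec_0: "recf_eval f xs y \<Longrightarrow> recf_eval (PrimRec f g) (0 # xs) y"
| PrimRec_Suc: "recf_eval (PrimRec f g) (m # xs) y \<Longrightarrow> recf_eval g (m # y # xs) z
    \<Longrightarrow> recf_eval (PrimRec f g) (Suc m # xs) z"
| Mu: "recf_eval f (m # xs) 0 \<Longrightarrow> (\<forall>i<m. \<exists>y. recf_eval f (i # xs) (Suc y))
    \<Longrightarrow> recf_eval (Mu f) xs m"

inductive_cases recf_evalE:
  "recf_eval Zero xs y"
  "recf_eval Succ xs y"
  "recf_eval (Proj i) xs y"
  "recf_eval (Comp f gs) xs y"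
  "recf_eval (PrimRec f g) (0 # xs) y"
  "recf_eval (PrimRec f g) (Suc m # xs) y"
  "recf_eval (Mu f) xs y"

lemma recf_eval_deterministic:
  "recf_eval e xs y \<Longrightarrow> recf_eval e xs z \<Longrightarrow> y = z"
proof (induction arbitrary: z rule: recf_eval.induct)
  case (Zero xs)
  then show ?case by (rule recf_evalE) simp
next
  case (Succ x)
  then show ?case by (rule recf_evalE) simp
next
  case (Proj i xs)
  from Proj.prems show ?case by (rule recf_evalE) simp
next
  case (Comp xs gs ys f z')
  from Comp.prems obtain ys' where
    *: "list_all2 (\<lambda>g y. recf_eval g xs y) gs ys'" "recf_eval f ys' z"
    by (rule recf_evalE)
  have "ys = ys'"
  proof (rule nth_equalityI)
    show len: "length ys = length ys'"
      using Comp.IH(1) *(1) by (simp add: list_all2_conv_all_nth)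
    show "ys ! i = ys' ! i" if "i < length ys" for i
      using Comp.IH(1) *(1) that unfolding list_all2_conv_all_nth by metis
  qed
  with Comp.IH(2) *(2) show ?case by blast
next
  case (PrimRec_0 f xs y g)
  from PrimRec_0.prems show ?case by (rule recf_evalE) (rule PrimRec_0.IH)
next
  case (PrimRec_Suc f g m xs y z')
  from PrimRec_Suc.prems obtain y' where
    "recf_eval (PrimRec f g) (m # xs) y'" "recf_eval g (m # y' # xs) z"
    by (rule recf_evalE)
  with PrimRec_Suc.IH show ?case by blast
next
  case (Mu f m xs)
  from Mu.prems have *: "recf_eval f (z # xs) 0" "\<forall>i<z. \<exists>y. recf_eval f (i # xs) (Suc y)"
    by (auto elim: recf_evalE(7))
  have "\<not> z < m" using Mu.IH(2) *(1) by (metis nat.distinct(1))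
  moreover have "\<not> m < z" using Mu.IH(1) *(2) by (metis nat.distinct(1))
  ultimately show ?case by simp
qed

text \<open>Total computable functions of one and of two arguments.\<close>

definition computable :: "(nat \<Rightarrow> nat) \<Rightarrow> bool" where
  "computable f \<longleftrightarrow> (\<exists>e. \<forall>x. recf_eval e [x] (f x))"

definition computable2 :: "(nat \<Rightarrow> nat \<Rightarrow> nat) \<Rightarrow> bool" where
  "computable2 f \<longleftrightarrow> (\<exists>e. \<forall>x y. recf_eval e [x, y] (f x y))"

section \<open>Approximability from above and bounded truth-table reducibility\<close>

definition approximable_from_above :: "nat \<Rightarrow> (nat \<Rightarrow> nat) \<Rightarrow> bool" where
  "approximable_from_above k h \<longleftrightarrow>
    (\<exists>g. computable2 g \<and>
      (\<forall>x. (\<lambda>s. g x s) \<longlonglongrightarrow> h x) \<and>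
      (\<forall>x s. g x (Suc s) \<le> g x s) \<and>
      (\<forall>x. finite {s. g x s \<noteq> g x (Suc s)} \<and> card {s. g x s \<noteq> g x (Suc s)} \<le> k))"

text \<open>
  The finite function \<open>\<beta>\<close> restricted to \<open>D\<close> is given to a computable function as the canonical
  index of its graph, a finite set of coded pairs. Canonical indices are given by
  \<open>set_encode\<close> and \<open>set_decode\<close>: \<open>set_decode u\<close> is the finite set $D_u$.
\<close>

definition restriction_code :: "(nat \<Rightarrow> nat) \<Rightarrow> nat set \<Rightarrow> nat" where
  "restriction_code \<beta> D = set_encode ((\<lambda>y. prod_encode (y, \<beta> y)) ` D)"

definition btt_reducible :: "nat \<Rightarrow> (nat \<Rightarrow> nat) \<Rightarrow> (nat \<Rightarrow> nat) \<Rightarrow> bool" where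
  "btt_reducible k \<alpha> \<beta> \<longleftrightarrow>
    (\<exists>p q. computable p \<and> computable2 q \<and>
      (\<forall>x. card (set_decode (p x)) \<le> k) \<and>
      (\<forall>x. \<alpha> x = q x (restriction_code \<beta> (set_decode (p x)))))"

section \<open>Computable graphs\<close>

text \<open>
  A graph is a symmetric irreflexive digraph without parallel arcs, possibly infinite
  (the locale \<open>pair_graph\<close> of the library would force finiteness).
\<close>

definition computable_graph :: "nat pair_pre_digraph \<Rightarrow> bool" where
  "computable_graph G \<longleftrightarrow>
    pair_bidirected_digraph G \<and>
    (pverts G = UNIV \<or> (\<exists>m. pverts G = {..<m})) \<and>
    computable2 (\<lambda>u v. of_bool ((u, v) \<in> parcs G))"

text \<open>
  The value \<open>0\<close> at codes of pairs outside the domain only matters for finite graphs, where the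
  distance function would otherwise be a finite partial function.
\<close>

definition distance_function :: "nat pair_pre_digraph \<Rightarrow> nat \<Rightarrow> nat" where
  "distance_function G x =
    (case prod_decode x of (u, v) \<Rightarrow>
      if u \<in> pverts G \<and> v \<in> pverts G
      then (LEAST l. \<exists>p. pre_digraph.apath (with_proj G) u p v \<and> length p = l)
      else 0)"

definition intrinsically_approximable_from_above :: "nat \<Rightarrow> nat pair_pre_digraph \<Rightarrow> bool" where
  "intrinsically_approximable_from_above k G \<longleftrightarrow>
    (\<forall>H. computable_graph H \<and> digraph_iso (with_proj G) (with_proj H) \<longrightarrow>
      approximable_from_above k (distance_function H))"

end

theory Submission
  imports Defs "HOL-Library.Infinite_Set"
begin

text \<open>
  Proof idea. Fix a root. Gadget \<open>x\<close> consists of infinitely many rays that start at the root and a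
  further vertex, the bud; the bud is joined to finitely many rays, at most one vertex on each, and
  the joints are at \<open>n + 1\<close> or fewer pairwise distinct heights. If \<open>g(x, -)\<close> approximates \<open>f(x)\<close> from
  above, let the bud of \<open>x\<close> be joined to ray \<open>s\<close> at height \<open>g(x, s)\<close> whenever \<open>s = 0\<close> or the value
  changed at \<open>s\<close>; this is decidable, and the bud ends up at distance \<open>f(x) + 2\<close> from the root. All
  other distances are determined by the final value \<open>f(x)\<close> for the one or two gadgets involved.
  Interleaving with a computable list in which every possible gadget occurs infinitely often makes
  the isomorphism type independent of \<open>f\<close>.

  In an arbitrary computable copy, approximate a distance by the distance in the finite part
  found so far, from the moment when the two vertices are connected. If the vertices belong to
  different gadgets, every path passes through the root, and each of the two distances to the root
  takes at most \<open>n + 1\<close> values; if they belong to the same gadget, the total number of possible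
  values is at most \<open>2n + 1\<close>.
\<close>

section \<open>Recursive functions in an environment\<close>

text \<open>The order in which a copy lists its vertices cannot be controlled, so a stage may show
  any finite induced subgraph: a short connection can stay hidden while a long detour is already
  visible. All counts must therefore hold uniformly in a vertex set \<open>V\<close>, and every
  candidate walk is described together with the vertices that it needs inside \<open>V\<close>. The
  count inside a gadget rests on shortcuts that remain inside \<open>V\<close>. If a walk enters and
  leaves the bud along the same ray, or descends to the root and climbs the same ray again, the part
  of the ray between the two ends is already present and the excursion can be cut. What survives is,
  up to the direct connections, one detour for each further joined ray and each direction. Every
  gadget has infinitely many rays so that, with only finitely many joined, infinitely many are
  always left unjoined: the stages at which the approximation changes then leave no trace in the
  isomorphism type. Whether ray \<open>s\<close> is joined depends on two successive values of the
  approximation alone, so adjacency is decidable although the final number of joints is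
  unknown.\<close>

definition recursive :: "nat \<Rightarrow> (nat list \<Rightarrow> nat) \<Rightarrow> bool" where
  "recursive k F \<longleftrightarrow> (\<exists>e. \<forall>xs. length xs = k \<longrightarrow> recf_eval e xs (F xs))"

lemma computable_iff_recursive: "computable f \<longleftrightarrow> recursive 1 (\<lambda>xs. f (xs ! 0))"
  unfolding computable_def recursive_def by (metis One_nat_def length_0_conv length_Suc_conv nth_Cons_0 length_Cons list.size(3))

lemma computable2_iff_recursive: "computable2 f \<longleftrightarrow> recursive 2 (\<lambda>xs. f (xs ! 0) (xs ! 1))"
proof
  assume "recursive 2 (\<lambda>xs. f (xs ! 0) (xs ! 1))"
  then obtain e where e: "\<And>xs. length xs = 2 \<Longrightarrow> recf_eval e xs (f (xs ! 0) (xs ! 1))"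
    unfolding recursive_def by blast
  from e[of "[x, y]" for x y] show "computable2 f" unfolding computable2_def by auto
next
  assume "computable2 f"
  then obtain e where e: "\<And>x y. recf_eval e [x, y] (f x y)"
    unfolding computable2_def by blast
  show "recursive 2 (\<lambda>xs. f (xs ! 0) (xs ! 1))"
    unfolding recursive_def by (rule exI[of _ e]) (auto simp: e numeral_2_eq_2 length_Suc_conv)
qed

lemma recursive_cong: "recursive k F \<Longrightarrow> (\<And>xs. length xs = k \<Longrightarrow> F xs = G xs) \<Longrightarrow> recursive k G"
  unfolding recursive_def by metis

lemma recursive_comp:
  assumes "recursive (length Gs) F" "\<And>G. G \<in> set Gs \<Longrightarrow> recursive k G"
  shows "recursive k (\<lambda>xs. F (map (\<lambda>G. G xs) Gs))"
proof -
  from assms(1) obtain f where f: "\<And>ys. length ys = length Gs \<Longrightarrow> recf_eval f ys (F ys)"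
    unfolding recursive_def by blast
  have "\<forall>G\<in>set Gs. \<exists>g. \<forall>xs. length xs = k \<longrightarrow> recf_eval g xs (G xs)"
    using assms(2) unfolding recursive_def by blast
  then obtain h where h: "\<And>G xs. G \<in> set Gs \<Longrightarrow> length xs = k \<Longrightarrow> recf_eval (h G) xs (G xs)"
    by metis
  show ?thesis unfolding recursive_def
  proof (intro exI allI impI)
    fix xs :: "nat list" assume "length xs = k"
    then show "recf_eval (Comp f (map h Gs)) xs (F (map (\<lambda>G. G xs) Gs))"
      by (intro recf_eval.Comp[where ys = "map (\<lambda>G. G xs) Gs"])
         (auto simp: list_all2_conv_all_nth h intro!: f)
  qed
qed

lemma recursive_comp1:
  assumes "recursive 1 (\<lambda>xs. f (xs ! 0))" "recursive k A"
  shows "recursive k (\<lambda>xs. f (A xs))"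
  using recursive_comp[of "[A]" "\<lambda>xs. f (xs ! 0)" k] assms by simp

lemma recursive_comp2:
  assumes "recursive 2 (\<lambda>xs. f (xs ! 0) (xs ! 1))" "recursive k A" "recursive k B"
  shows "recursive k (\<lambda>xs. f (A xs) (B xs))"
proof -
  have "recursive (length [A, B]) (\<lambda>xs. f (xs ! 0) (xs ! 1))"
    using assms(1) by (simp add: numeral_2_eq_2)
  from recursive_comp[OF this, of k] show ?thesis using assms(2,3) by auto
qed

lemma recursive_comp3:
  assumes "recursive 3 (\<lambda>xs. f (xs ! 0) (xs ! 1) (xs ! 2))" "recursive k A" "recursive k B" "recursive k C"
  shows "recursive k (\<lambda>xs. f (A xs) (B xs) (C xs))"
proof -
  have "recursive (length [A, B, C]) (\<lambda>xs. f (xs ! 0) (xs ! 1) (xs ! 2))"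
    using assms(1) by (simp add: numeral_3_eq_3)
  from recursive_comp[OF this, of k] show ?thesis using assms(2-) by auto
qed

lemma recursive_nth: "i < k \<Longrightarrow> recursive k (\<lambda>xs. xs ! i)"
  unfolding recursive_def by (rule exI[of _ "Proj i"]) (auto intro: recf_eval.Proj)

lemma recursive_tl_nth: "Suc i < k \<Longrightarrow> recursive k (\<lambda>xs. tl xs ! i)"
  by (rule recursive_cong[OF recursive_nth[of "Suc i"]]) (auto simp: nth_tl)

lemma recursive_tl2_nth: "Suc (Suc i) < k \<Longrightarrow> recursive k (\<lambda>xs. tl (tl xs) ! i)"
  by (rule recursive_cong[OF recursive_nth[of "Suc (Suc i)"]]) (auto simp: nth_tl)

lemma recursive_hd: "0 < k \<Longrightarrow> recursive k hd"
  by (rule recursive_cong[OF recursive_nth[of 0]]) (auto simp: hd_conv_nth)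

lemma recursive_hd_tl: "Suc 0 < k \<Longrightarrow> recursive k (\<lambda>xs. hd (tl xs))"
  by (rule recursive_cong[OF recursive_nth[of 1]])
    (simp, case_tac xs rule: remdups_adj.cases, auto)

lemma recursive_Suc: "recursive k A \<Longrightarrow> recursive k (\<lambda>xs. Suc (A xs))"
proof (rule recursive_comp1[of Suc])
  show "recursive 1 (\<lambda>xs. Suc (xs ! 0))"
    unfolding recursive_def by (rule exI[of _ Succ]) (auto simp: length_Suc_conv intro: recf_eval.Succ)
qed

lemma recursive_const: "recursive k (\<lambda>xs. c)"
proof (induction c)
  case 0
  show ?case unfolding recursive_def by (rule exI[of _ Zero]) (auto intro: recf_eval.Zero)
qed (rule recursive_Suc)

text \<open>Bound variables are pushed onto the front of the environment.\<close>

lemma recursive_primrec: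
  assumes F: "recursive k F" and G: "recursive (Suc (Suc k)) (\<lambda>ys. G (hd ys) (hd (tl ys)) (tl (tl ys)))"
    and N: "recursive k N"
  shows "recursive k (\<lambda>xs. rec_nat (F xs) (\<lambda>m y. G m y xs) (N xs))"
proof -
  from F obtain f where f: "\<And>xs. length xs = k \<Longrightarrow> recf_eval f xs (F xs)"
    unfolding recursive_def by blast
  from G obtain g where g: "\<And>ys. length ys = Suc (Suc k) \<Longrightarrow> recf_eval g ys (G (hd ys) (hd (tl ys)) (tl (tl ys)))"
    unfolding recursive_def by blast
  have "recf_eval (PrimRec f g) (n # xs) (rec_nat (F xs) (\<lambda>m y. G m y xs) n)" if "length xs = k" for n xs
  proof (induction n)
    case 0 then show ?case using f[OF that] by (auto intro: recf_eval.PrimRec_0)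
  next
    case (Suc n)
    then show ?case using g[of "n # _ # xs"] that by (auto intro!: recf_eval.PrimRec_Suc[OF Suc])
  qed
  then have *: "recursive (Suc k) (\<lambda>ys. rec_nat (F (tl ys)) (\<lambda>m y. G m y (tl ys)) (hd ys))"
    unfolding recursive_def by (intro exI[of _ "PrimRec f g"]) (auto simp: length_Suc_conv)
  \<comment> \<open>Composing with all projections rebuilds the environment behind the counter, so
    the recursion can be run up to an arbitrary function \<open>N\<close> of it.\<close>
  let ?Gs = "N # map (\<lambda>i xs. xs ! i) [0..<k]"
  have "recursive k (\<lambda>xs. (\<lambda>ys. rec_nat (F (tl ys)) (\<lambda>m y. G m y (tl ys)) (hd ys)) (map (\<lambda>G. G xs) ?Gs))"
    by (rule recursive_comp) (use * N in \<open>auto intro: recursive_nth\<close>)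
  then show ?thesis
    by (rule recursive_cong) (simp add: comp_def, metis map_nth)
qed

lemma recursive_add:
  assumes "recursive k A" "recursive k B" shows "recursive k (\<lambda>xs. A xs + B xs)"
proof -
  have "rec_nat a (\<lambda>m y. Suc y) b = a + b" for a b by (induction b) auto
  then show ?thesis
    using recursive_primrec[OF assms(1) _ assms(2), of "\<lambda>m y xs. Suc y"]
    by (simp add: recursive_Suc recursive_hd_tl)
qed

lemma recursive_pred: assumes "recursive k A" shows "recursive k (\<lambda>xs. A xs - 1)"
proof -
  have "rec_nat 0 (\<lambda>m y. m) b = b - 1" for b by (induction b) auto
  then show ?thesis
    using recursive_primrec[OF recursive_const[of k 0] _ assms, of "\<lambda>m y xs. m"]
    by (simp add: recursive_hd)
qed

lemma recursive_diff:
  assumes "recursive k A" "recursive k B" shows "recursive k (\<lambda>xs. A xs - B xs)"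
proof -
  have "rec_nat a (\<lambda>m y. y - 1) b = a - b" for a b by (induction b) auto
  then show ?thesis
    using recursive_primrec[OF assms(1) _ assms(2), of "\<lambda>m y xs. y - 1"]
      recursive_pred[OF recursive_hd_tl] by simp
qed

text \<open>Bounded sums carry most of what follows: products, bounded quantifiers, division by
  powers of two, bit masks and table lookup are all written as such sums.\<close>

lemma recursive_sum:
  assumes "recursive (Suc k) (\<lambda>ys. F (hd ys) (tl ys))" "recursive k N"
  shows "recursive k (\<lambda>xs. \<Sum>i<N xs. F i xs)"
proof -
  have *: "rec_nat 0 (\<lambda>m y. y + F m xs) n = (\<Sum>i<n. F i xs)" for xs n by (induction n) auto
  \<comment> \<open>The step function of the recursion sees index, accumulator and environment; this
    composition drops the accumulator, which the summand does not see.\<close>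
  let ?Gs = "(\<lambda>xs. xs ! 0) # map (\<lambda>i xs. xs ! Suc (Suc i)) [0..<k] :: (nat list \<Rightarrow> nat) list"
  have "recursive (Suc (Suc k)) (\<lambda>xs. (\<lambda>ys. F (hd ys) (tl ys)) (map (\<lambda>G. G xs) ?Gs))"
    by (rule recursive_comp) (use assms(1) in \<open>auto intro: recursive_nth\<close>)
  then have "recursive (Suc (Suc k)) (\<lambda>ys. F (hd ys) (tl (tl ys)))"
  proof (rule recursive_cong)
    fix xs :: "nat list" assume "length xs = Suc (Suc k)"
    then obtain a b ys where "xs = a # b # ys" "length ys = k" by (auto simp: length_Suc_conv)
    moreover then have "map (\<lambda>i. ys ! i) [0..<k] = ys" by (metis map_nth)
    ultimately show "(\<lambda>ys. F (hd ys) (tl ys)) (map (\<lambda>G. G xs) ?Gs) = F (hd xs) (tl (tl xs))"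
      by (simp add: comp_def)
  qed
  then have "recursive (Suc (Suc k)) (\<lambda>ys. hd (tl ys) + F (hd ys) (tl (tl ys)))"
    by (intro recursive_add recursive_hd_tl) auto
  from recursive_primrec[OF recursive_const[of k 0] this assms(2)] show ?thesis unfolding * .
qed

lemma recursive_mult:
  assumes "recursive k A" "recursive k B" shows "recursive k (\<lambda>xs. A xs * B xs)"
proof -
  have "recursive 2 (\<lambda>xs. \<Sum>i<xs ! 0. xs ! 1)"
    by (intro recursive_sum recursive_tl_nth recursive_nth) auto
  from recursive_comp2[of "\<lambda>a b. a * b", OF _ assms] this show ?thesis by simp
qed

lemma recursive_pow2:
  assumes "recursive k A" shows "recursive k (\<lambda>xs. 2 ^ A xs)"
proof -
  have "rec_nat 1 (\<lambda>m y. y + y) n = (2::nat) ^ n" for n by (induction n) auto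
  then show ?thesis
    using recursive_primrec[OF recursive_const[of k 1] _ assms, of "\<lambda>m y xs. y + y"]
      recursive_add[OF recursive_hd_tl recursive_hd_tl] by simp
qed

section \<open>Decidable predicates, search, and decoding of finite sets and pairs\<close>

abbreviation decidable :: "nat \<Rightarrow> (nat list \<Rightarrow> bool) \<Rightarrow> bool" where
  "decidable k P \<equiv> recursive k (\<lambda>xs. of_bool (P xs))"

lemma decidable_le:
  assumes "recursive k A" "recursive k B" shows "decidable k (\<lambda>xs. A xs \<le> B xs)"
  using recursive_diff[OF recursive_const[of k 1] recursive_diff[OF assms]]
  by (rule recursive_cong) auto

lemma decidable_not:
  assumes "decidable k P" shows "decidable k (\<lambda>xs. \<not> P xs)"
  using recursive_diff[OF recursive_const[of k 1] assms]
  by (rule recursive_cong) auto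

lemma decidable_conj:
  assumes "decidable k P" "decidable k Q" shows "decidable k (\<lambda>xs. P xs \<and> Q xs)"
  using recursive_mult[OF assms] by (rule recursive_cong) auto

lemma decidable_disj:
  assumes "decidable k P" "decidable k Q" shows "decidable k (\<lambda>xs. P xs \<or> Q xs)"
  using decidable_not[OF decidable_conj[OF assms[THEN decidable_not]]] by simp

lemma decidable_less:
  assumes "recursive k A" "recursive k B" shows "decidable k (\<lambda>xs. A xs < B xs)"
  using decidable_not[OF decidable_le[OF assms(2,1)]] by (simp add: not_le)

lemma decidable_eq:
  assumes "recursive k A" "recursive k B" shows "decidable k (\<lambda>xs. A xs = B xs)"
  using decidable_conj[OF decidable_le[OF assms] decidable_le[OF assms(2,1)]]
  by (rule recursive_cong) auto


lemma recursive_if: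
  assumes "decidable k P" "recursive k A" "recursive k B"
  shows "recursive k (\<lambda>xs. if P xs then A xs else B xs)"
  using recursive_add[OF recursive_mult[OF assms(1,2)] recursive_mult[OF decidable_not[OF assms(1)] assms(3)]]
  by (rule recursive_cong) auto

lemma decidable_bex:
  assumes "decidable (Suc k) (\<lambda>ys. P (hd ys) (tl ys))" "recursive k N"
  shows "decidable k (\<lambda>xs. \<exists>i<N xs. P i xs)"
  using decidable_less[OF recursive_const[of k 0] recursive_sum[OF assms]]
  by (rule recursive_cong) (auto simp: Bex_def)

lemma recursive_min:
  assumes "recursive k A" "recursive k B" shows "recursive k (\<lambda>xs. min (A xs) (B xs))"
  unfolding min_def by (intro recursive_if decidable_le assms)

lemma recursive_Mu:
  assumes "decidable (Suc k) (\<lambda>ys. P (hd ys) (tl ys))" "\<And>xs. length xs = k \<Longrightarrow> \<exists>i. P i xs"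
  shows "recursive k (\<lambda>xs. LEAST i. P i xs)"
proof -
  \<comment> \<open>\<open>Mu\<close> looks for a zero, so the program has to compute the negation
    of \<open>P\<close>.\<close>
  from decidable_not[OF assms(1)] obtain e where
    e: "\<And>ys. length ys = Suc k \<Longrightarrow> recf_eval e ys (of_bool (\<not> P (hd ys) (tl ys)))"
    unfolding recursive_def by blast
  show ?thesis unfolding recursive_def
  proof (intro exI allI impI)
    fix xs :: "nat list" assume xs: "length xs = k"
    show "recf_eval (Mu e) xs (LEAST i. P i xs)"
    proof (rule recf_eval.Mu)
      show "recf_eval e ((LEAST i. P i xs) # xs) 0"
        using e[of "(LEAST i. P i xs) # xs"] xs LeastI_ex[OF assms(2)[OF xs]] by simp
      show "\<forall>i<LEAST i. P i xs. \<exists>y. recf_eval e (i # xs) (Suc y)"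
      proof (intro allI impI)
        fix i assume "i < (LEAST i. P i xs)"
        then have "\<not> P i xs" by (rule not_less_Least)
        then show "\<exists>y. recf_eval e (i # xs) (Suc y)" using e[of "i # xs"] xs by auto
      qed
    qed
  qed
qed

lemmas recursive_intros =
  recursive_if recursive_min recursive_nth recursive_tl_nth recursive_tl2_nth
  recursive_hd recursive_hd_tl recursive_Suc recursive_const recursive_add recursive_diff recursive_mult
  recursive_pow2 recursive_sum decidable_le decidable_less decidable_eq decidable_not
  decidable_conj decidable_disj decidable_bex

text \<open>The quotient is the number of positive multiples of the divisor up to the dividend. With
  parity this yields binary digits, hence membership in \<open>set_decode\<close>.\<close>

lemma recursive_div2_pow:
  assumes "recursive k A" "recursive k B" shows "recursive k (\<lambda>xs. A xs div 2 ^ B xs)"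
proof -
  have "(\<Sum>i<a. of_bool ((i + 1) * 2 ^ b \<le> a)) = a div 2 ^ b" for a b :: nat
  proof -
    define d where "d = a div 2 ^ b"
    have "(i + 1) * 2 ^ b \<le> a \<longleftrightarrow> i < d" for i
      unfolding d_def by (metis Suc_eq_plus1 Suc_le_eq less_eq_div_iff_mult_less_eq pos2 zero_less_power)
    moreover have "d \<le> a" unfolding d_def by (rule div_le_dividend)
    then have "{..<a} \<inter> {i. i < d} = {..<d}" by auto
    ultimately show ?thesis by (simp add: of_bool_def sum.If_cases flip: d_def)
  qed
  moreover have "recursive 2 (\<lambda>xs. \<Sum>i<xs ! 0. of_bool ((i + 1) * 2 ^ (xs ! 1) \<le> xs ! 0))"
    by (intro recursive_intros) auto
  ultimately show ?thesis using recursive_comp2[of "\<lambda>a b. a div 2 ^ b", OF _ assms] by simp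
qed

lemma recursive_div2: "recursive k A \<Longrightarrow> recursive k (\<lambda>xs. A xs div 2)"
  using recursive_div2_pow[OF _ recursive_const[of k 1], of A] by simp

lemma decidable_even: assumes "recursive k A" shows "decidable k (\<lambda>xs. even (A xs))"
proof -
  have "decidable k (\<lambda>xs. 2 * (A xs div 2) = A xs)"
    by (intro recursive_intros recursive_div2 assms)
  moreover have "2 * (a div 2) = a \<longleftrightarrow> even a" for a :: nat by presburger
  ultimately show ?thesis by simp
qed

lemma decidable_set_decode:
  assumes "recursive k A" "recursive k B" shows "decidable k (\<lambda>xs. A xs \<in> set_decode (B xs))"
  unfolding set_decode_def mem_Collect_eq
  by (intro decidable_not decidable_even recursive_div2_pow assms)

lemma recursive_prod_encode:
  assumes "recursive k A" "recursive k B" shows "recursive k (\<lambda>xs. prod_encode (A xs, B xs))"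
proof -
  have "recursive k (\<lambda>xs. (A xs + B xs) * Suc (A xs + B xs) div 2 + A xs)"
    by (intro recursive_intros recursive_div2 assms)
  then show ?thesis by (simp add: prod_encode_def triangle_def)
qed

text \<open>Search for one component is unbounded, for the other bounded by the code itself; the
  pairing is a bijection, so the least hit is the only one.\<close>

lemma
  assumes "recursive k A"
  shows recursive_fst_prod_decode: "recursive k (\<lambda>xs. fst (prod_decode (A xs)))"
    and recursive_snd_prod_decode: "recursive k (\<lambda>xs. snd (prod_decode (A xs)))"
proof -
  have eq: "prod_encode (a, b) = z \<longleftrightarrow> a = fst (prod_decode z) \<and> b = snd (prod_decode z)" for a b z
    by (metis prod.collapse prod_encode_inverse prod_decode_inverse fst_conv snd_conv)
  have le: "fst (prod_decode z) < Suc z" "snd (prod_decode z) < Suc z" for z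
    by (metis less_Suc_eq_le le_prod_encode_1 le_prod_encode_2 prod.collapse prod_decode_inverse)+
  have "(LEAST a. \<exists>b<Suc z. prod_encode (a, b) = z) = fst (prod_decode z)" for z
    by (rule Least_equality) (auto simp: eq le)
  moreover have "recursive 1 (\<lambda>xs. LEAST a. \<exists>b<Suc (xs ! 0). prod_encode (a, b) = xs ! 0)"
    by (intro recursive_Mu recursive_intros recursive_prod_encode) (use eq le in auto)
  ultimately show "recursive k (\<lambda>xs. fst (prod_decode (A xs)))"
    using recursive_comp1[of "\<lambda>z. fst (prod_decode z)", OF _ assms] by simp
  have "(LEAST b. \<exists>a<Suc z. prod_encode (a, b) = z) = snd (prod_decode z)" for z
    by (rule Least_equality) (auto simp: eq le)
  moreover have "recursive 1 (\<lambda>xs. LEAST b. \<exists>a<Suc (xs ! 0). prod_encode (a, b) = xs ! 0)"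
    by (intro recursive_Mu recursive_intros recursive_prod_encode) (use eq le in auto)
  ultimately show "recursive k (\<lambda>xs. snd (prod_decode (A xs)))"
    using recursive_comp1[of "\<lambda>z. snd (prod_decode z)", OF _ assms] by simp
qed

section \<open>Distances in induced subgraphs\<close>

text \<open>Relative to a vertex set, because a stage of the approximation sees only an induced
  subgraph. The clause \<open>u \<in> V\<close> is what a walk of length 0 still has to
  satisfy.\<close>

definition walk_in :: "'a rel \<Rightarrow> 'a set \<Rightarrow> 'a \<Rightarrow> 'a \<Rightarrow> nat \<Rightarrow> bool" where
  "walk_in E V u v l \<longleftrightarrow> u \<in> V \<and> (u, v) \<in> (E \<inter> V \<times> V) ^^ l"

lemma walk_in_0: "walk_in E V u v 0 \<longleftrightarrow> u \<in> V \<and> v = u"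
  by (auto simp: walk_in_def)

lemma walk_in_Suc: "walk_in E V u v (Suc l) \<longleftrightarrow> (\<exists>w. walk_in E V u w l \<and> (w, v) \<in> E \<and> w \<in> V \<and> v \<in> V)"
  by (auto simp: walk_in_def)

lemma walk_in_verts: "walk_in E V u v l \<Longrightarrow> u \<in> V \<and> v \<in> V"
  by (cases l) (auto simp: walk_in_0 walk_in_Suc walk_in_def)

lemma walk_in_edge: "(u, v) \<in> E \<Longrightarrow> u \<in> V \<Longrightarrow> v \<in> V \<Longrightarrow> walk_in E V u v (Suc 0)"
  by (auto simp: walk_in_def)

lemma walk_in_trans: "walk_in E V u v k \<Longrightarrow> walk_in E V v w l \<Longrightarrow> walk_in E V u w (k + l)"
  unfolding walk_in_def by (auto simp: relpow_add)

lemma walk_in_sym: "sym E \<Longrightarrow> walk_in E V u v l \<Longrightarrow> walk_in E V v u l"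
proof (induction l arbitrary: v)
  case (Suc l)
  then obtain w where w: "walk_in E V u w l" "(w, v) \<in> E" "w \<in> V" "v \<in> V"
    by (auto simp: walk_in_Suc)
  then have "walk_in E V v w (Suc 0)" using Suc.prems(1) by (auto intro: walk_in_edge symD)
  from walk_in_trans[OF this Suc.IH[OF Suc.prems(1) w(1)]] show ?case by simp
qed (auto simp: walk_in_0)

lemma walk_in_mono: "walk_in E V u v l \<Longrightarrow> V \<subseteq> W \<Longrightarrow> walk_in E W u v l"
  by (induction l arbitrary: v) (auto simp: walk_in_0 walk_in_Suc)

text \<open>This gives convergence: every walk of the whole graph is visible from some finite stage
  on.\<close>

lemma walk_in_finite:
  "walk_in E V u v l \<Longrightarrow> \<exists>W\<subseteq>V. finite W \<and> walk_in E W u v l"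
proof (induction l arbitrary: v)
  case 0 then show ?case by (auto simp: walk_in_0 intro!: exI[of _ "{u}"])
next
  case (Suc l)
  then obtain w W where "walk_in E W u w l" "(w, v) \<in> E" "w \<in> V" "v \<in> V" "W \<subseteq> V" "finite W"
    unfolding walk_in_Suc by blast
  then show ?case
    by (intro exI[of _ "insert v W"]) (auto simp: walk_in_Suc dest: walk_in_verts intro: walk_in_mono)
qed

section \<open>The gadget graph and the shape of its shortest walks\<close>

datatype vert = Root | Bud nat | Node nat nat nat

text \<open>
  \<open>c x s = Suc j\<close> says that the bud of gadget \<open>x\<close> is joined to ray \<open>s\<close> at height \<open>j\<close>, and \<open>c x s = 0\<close> that
  it is not joined to ray \<open>s\<close>.
\<close>

inductive arc :: "(nat \<Rightarrow> nat \<Rightarrow> nat) \<Rightarrow> vert \<Rightarrow> vert \<Rightarrow> bool" for c where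
  "arc c Root (Node x s 0)"
| "arc c (Node x s j) (Node x s (Suc j))"
| "c x s = Suc j \<Longrightarrow> arc c (Node x s j) (Bud x)"

definition edges :: "(nat \<Rightarrow> nat \<Rightarrow> nat) \<Rightarrow> vert rel" where
  "edges c = {(u, v). arc c u v \<or> arc c v u}"

lemma sym_edges: "sym (edges c)"
  by (auto simp: edges_def sym_def)

lemma edges_cases:
  assumes "(v, w) \<in> edges c"
  obtains (up_root) x s where "v = Root" "w = Node x s 0"
  | (down_root) x s where "w = Root" "v = Node x s 0"
  | (up) x s j where "v = Node x s j" "w = Node x s (Suc j)"
  | (down) x s j where "w = Node x s j" "v = Node x s (Suc j)"
  | (to_bud) x s j where "v = Node x s j" "w = Bud x" "c x s = Suc j"
  | (from_bud) x s j where "w = Node x s j" "v = Bud x" "c x s = Suc j"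
  using assms unfolding edges_def by (auto elim!: arc.cases)

definition segment :: "vert set \<Rightarrow> nat \<Rightarrow> nat \<Rightarrow> nat \<Rightarrow> nat \<Rightarrow> bool" where
  "segment V x s i j \<longleftrightarrow> (\<forall>k. min i j \<le> k \<and> k \<le> max i j \<longrightarrow> Node x s k \<in> V)"

text \<open>With truncated subtraction this is the absolute difference, in a form to which the
  closure rules for \<open>recursive\<close> apply.\<close>

definition gap :: "nat \<Rightarrow> nat \<Rightarrow> nat" where
  "gap i j = (i - j) + (j - i)"

lemma segment_trans: "segment V x s i j \<Longrightarrow> segment V x s j k \<Longrightarrow> segment V x s i k"
  unfolding segment_def by (metis le_max_iff_disj linorder_le_cases max.absorb1 max.absorb2 min_le_iff_disj)

lemma segment_sym: "segment V x s i j \<longleftrightarrow> segment V x s j i"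
  unfolding segment_def by (simp add: min.commute max.commute)

lemma segment_step: "Node x s j \<in> V \<Longrightarrow> Node x s (Suc j) \<in> V \<Longrightarrow> segment V x s j (Suc j)"
  unfolding segment_def by (auto simp: le_Suc_eq)

lemma segment_refl: "segment V x s j j \<longleftrightarrow> Node x s j \<in> V"
  unfolding segment_def by auto

lemma segment_verts: "segment V x s i j \<Longrightarrow> Node x s i \<in> V \<and> Node x s j \<in> V"
  unfolding segment_def by auto

text \<open>
  The candidates for shortest walks inside \<open>V\<close>: along one ray, through the bud without the root, or
  through the root. A walk between a vertex and the root goes straight down its own ray, or to the
  bud first and then down a joined ray.
\<close>

fun ray_route :: "vert set \<Rightarrow> vert \<Rightarrow> vert \<Rightarrow> nat \<Rightarrow> bool" where
  "ray_route V Root Root k \<longleftrightarrow> Root \<in> V \<and> k = 0"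
| "ray_route V (Bud x) (Bud y) k \<longleftrightarrow> x = y \<and> Bud x \<in> V \<and> k = 0"
| "ray_route V (Node x s i) (Node y t j) k \<longleftrightarrow> x = y \<and> s = t \<and> segment V x s i j \<and> k = gap i j"
| "ray_route V _ _ k \<longleftrightarrow> False"

fun stem_route :: "vert set \<Rightarrow> vert \<Rightarrow> nat \<Rightarrow> bool" where
  "stem_route V Root k \<longleftrightarrow> Root \<in> V \<and> k = 0"
| "stem_route V (Bud x) k \<longleftrightarrow> False"
| "stem_route V (Node x s j) k \<longleftrightarrow> Root \<in> V \<and> segment V x s 0 j \<and> k = Suc j"

fun bud_route :: "(nat \<Rightarrow> nat \<Rightarrow> nat) \<Rightarrow> vert set \<Rightarrow> vert \<Rightarrow> nat \<Rightarrow> nat \<Rightarrow> bool" where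
  "bud_route c V Root x k \<longleftrightarrow> False"
| "bud_route c V (Bud y) x k \<longleftrightarrow> y = x \<and> Bud x \<in> V \<and> k = 0"
| "bud_route c V (Node y s j) x k \<longleftrightarrow> y = x \<and> (\<exists>v. c x s = Suc v \<and> Bud x \<in> V \<and> segment V x s j v \<and> k = Suc (gap j v))"

text \<open>The length is one edge from the bud to height \<open>v\<close>, then \<open>v\<close>
  edges down the ray, then one edge to the root.\<close>

definition cross_route :: "(nat \<Rightarrow> nat \<Rightarrow> nat) \<Rightarrow> vert set \<Rightarrow> nat \<Rightarrow> nat \<Rightarrow> nat \<Rightarrow> bool" where
  "cross_route c V x s k \<longleftrightarrow> (\<exists>v. c x s = Suc v \<and> Root \<in> V \<and> Bud x \<in> V \<and> segment V x s 0 v \<and> k = Suc (Suc v))"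

definition root_route :: "(nat \<Rightarrow> nat \<Rightarrow> nat) \<Rightarrow> vert set \<Rightarrow> vert \<Rightarrow> nat \<Rightarrow> bool" where
  "root_route c V u k \<longleftrightarrow> stem_route V u k \<or>
    (\<exists>x s k1 k2. bud_route c V u x k1 \<and> cross_route c V x s k2 \<and> k = k1 + k2)"

definition route :: "(nat \<Rightarrow> nat \<Rightarrow> nat) \<Rightarrow> vert set \<Rightarrow> vert \<Rightarrow> vert \<Rightarrow> nat \<Rightarrow> bool" where
  "route c V u v k \<longleftrightarrow> ray_route V u v k \<or>
    (\<exists>x k1 k2. bud_route c V u x k1 \<and> bud_route c V v x k2 \<and> k = k1 + k2) \<or>
    (\<exists>k1 k2. root_route c V u k1 \<and> root_route c V v k2 \<and> k = k1 + k2)"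

lemma route_refl: "u \<in> V \<Longrightarrow> route c V u u 0"
  by (cases u) (auto simp: route_def segment_refl gap_def)

lemma ray_route_sym: "ray_route V u v k \<longleftrightarrow> ray_route V v u k"
  by (cases u; cases v) (auto simp: segment_sym gap_def)

lemma route_sym: "route c V u v k \<longleftrightarrow> route c V v u k"
proof -
  have "route c V v u k" if "route c V u v k" for u v
    using that unfolding route_def ray_route_sym[of V u v]
    by (elim disjE exE conjE) (simp, metis add.commute, metis add.commute)
  then show ?thesis by blast
qed

lemma segment_walk_up:
  "(\<And>k. i \<le> k \<Longrightarrow> k \<le> i + d \<Longrightarrow> Node x s k \<in> V) \<Longrightarrow> walk_in (edges c) V (Node x s i) (Node x s (i + d)) d"
proof (induction d)
  case (Suc d)
  then have "walk_in (edges c) V (Node x s i) (Node x s (i + d)) d" by simp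
  moreover have "(Node x s (i + d), Node x s (i + Suc d)) \<in> edges c"
    by (auto simp: edges_def intro: arc.intros)
  ultimately show ?case unfolding walk_in_Suc using Suc.prems by (intro exI[of _ "Node x s (i + d)"]) auto
qed (auto simp: walk_in_0)

lemma segment_walk: "segment V x s i j \<Longrightarrow> walk_in (edges c) V (Node x s i) (Node x s j) (gap i j)"
proof (induction i j rule: linorder_wlog)
  case (le i j)
  then show ?case using segment_walk_up[of i "j - i" x s V c] by (auto simp: segment_def gap_def)
next
  case (sym i j)
  then show ?case using walk_in_sym[OF sym_edges] by (metis add.commute gap_def segment_sym)
qed

lemma ray_route_walk: "ray_route V u v k \<Longrightarrow> walk_in (edges c) V u v k"
  by (cases u; cases v) (auto simp: walk_in_0 intro: segment_walk)

lemma stem_route_walk: "stem_route V u k \<Longrightarrow> walk_in (edges c) V u Root k"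
proof (cases u)
  case (Node x s j)
  assume "stem_route V u k"
  with Node have *: "Root \<in> V" "segment V x s 0 j" "k = Suc j" by auto
  have "(Root, Node x s 0) \<in> edges c" by (auto simp: edges_def intro: arc.intros)
  then have "walk_in (edges c) V Root (Node x s 0) (Suc 0)"
    using * by (auto intro!: walk_in_edge dest: segment_verts)
  from walk_in_trans[OF this segment_walk[OF *(2)]] show ?thesis
    using walk_in_sym[OF sym_edges] * Node by (auto simp: gap_def)
qed (auto simp: walk_in_0)

lemma bud_route_walk: "bud_route c V u x k \<Longrightarrow> walk_in (edges c) V u (Bud x) k"
proof (cases u)
  case (Node y s j)
  assume "bud_route c V u x k"
  with Node obtain v where *: "c x s = Suc v" "Bud x \<in> V" "segment V x s j v" "k = Suc (gap j v)" "y = x" by auto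
  have "(Node x s v, Bud x) \<in> edges c" using * by (auto simp: edges_def intro: arc.intros)
  then have "walk_in (edges c) V (Node x s v) (Bud x) (Suc 0)"
    using * by (auto intro!: walk_in_edge dest: segment_verts)
  from walk_in_trans[OF segment_walk[OF *(3)] this] show ?thesis
    using * Node by auto
qed (auto simp: walk_in_0)

lemma cross_route_walk: "cross_route c V x s k \<Longrightarrow> walk_in (edges c) V (Bud x) Root k"
proof -
  assume "cross_route c V x s k"
  then obtain v where *: "c x s = Suc v" "Root \<in> V" "Bud x \<in> V" "segment V x s 0 v" "k = Suc (Suc v)"
    by (auto simp: cross_route_def)
  have "bud_route c V (Node x s v) x 1" "stem_route V (Node x s v) (Suc v)"
    using * by (auto simp: gap_def segment_refl dest: segment_verts)
  then show ?thesis
    using walk_in_trans[OF walk_in_sym[OF sym_edges bud_route_walk] stem_route_walk] * by fastforce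
qed

lemma root_route_walk: "root_route c V u k \<Longrightarrow> walk_in (edges c) V u Root k"
  unfolding root_route_def
  by (elim disjE exE conjE) (auto intro: stem_route_walk walk_in_trans[OF bud_route_walk cross_route_walk])

lemma route_walk: "route c V u v k \<Longrightarrow> walk_in (edges c) V u v k"
  unfolding route_def
  by (elim disjE exE conjE)
    (auto intro: ray_route_walk walk_in_trans[OF bud_route_walk walk_in_sym[OF sym_edges bud_route_walk]]
      walk_in_trans[OF root_route_walk walk_in_sym[OF sym_edges root_route_walk]])

lemma stem_route_step:
  assumes "stem_route V v k" "(v, w) \<in> edges c" "w \<in> V"
  shows "\<exists>k'\<le>Suc k. root_route c V w k'"
  using assms(2)
proof (cases rule: edges_cases)
  case (to_bud x s j)
  \<comment> \<open>The stem below the joint together with the edge to the bud is a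
    \<open>cross_route\<close>; this is the one way of leaving the stem routes, and the reason why
    the conclusion speaks of \<open>root_route\<close>.\<close>
  then have "cross_route c V x s (Suc k)" "bud_route c V w x 0"
    using assms by (auto simp: cross_route_def)
  then show ?thesis unfolding root_route_def by (metis add_0 order_refl)
next
  case (down x s j)
  have "stem_route V w (Suc j)"
    using assms down by (auto intro: segment_trans segment_step[THEN segment_sym[THEN iffD1]] dest: segment_verts)
  then show ?thesis using assms down unfolding root_route_def by (intro exI[of _ "Suc j"]) auto
next
  case (up x s j)
  then have "stem_route V w (Suc (Suc j))"
    using assms up by (auto intro: segment_trans segment_step dest: segment_verts)
  then show ?thesis using assms up unfolding root_route_def by (intro exI[of _ "Suc (Suc j)"]) auto
qed (use assms in \<open>auto simp: root_route_def segment_refl\<close>)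

text \<open>A walk from the bud along a joined ray leaves the family only at the foot of the ray,
  and then the whole walk is a \<open>cross_route\<close> to the root.\<close>

lemma bud_route_step:
  assumes "bud_route c V v x k" "(v, w) \<in> edges c" "w \<in> V"
  shows "(\<exists>k'\<le>Suc k. bud_route c V w x k') \<or> w = Root \<and> (\<exists>s. \<exists>k'\<le>Suc k. cross_route c V x s k')"
  using assms(2)
proof (cases rule: edges_cases)
  case (up y s j)
  then obtain a where a: "y = x" "c x s = Suc a" "Bud x \<in> V" "segment V x s j a" "k = Suc (gap j a)"
    using assms by auto
  then have "segment V x s (Suc j) a"
    using assms up by (meson segment_step segment_sym segment_trans segment_verts)
  then show ?thesis using up a by (intro disjI1 exI[of _ "Suc (gap (Suc j) a)"]) (auto simp: gap_def)
next
  case (down y s j)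
  then obtain a where a: "y = x" "c x s = Suc a" "Bud x \<in> V" "segment V x s (Suc j) a" "k = Suc (gap (Suc j) a)"
    using assms by auto
  then have "segment V x s j a"
    using assms down by (meson segment_step segment_sym segment_trans segment_verts)
  then show ?thesis using down a by (intro disjI1 exI[of _ "Suc (gap j a)"]) (auto simp: gap_def)
qed (use assms in \<open>auto simp: cross_route_def segment_refl gap_def\<close>)

lemma root_route_step:
  assumes "root_route c V v k" "(v, w) \<in> edges c" "w \<in> V"
  shows "\<exists>k'\<le>Suc k. root_route c V w k'"
proof (cases "stem_route V v k")
  case True
  then show ?thesis using stem_route_step assms by blast
next
  case False
  then obtain x s k1 k2 where *: "bud_route c V v x k1" "cross_route c V x s k2" "k = k1 + k2"
    using assms unfolding root_route_def by blast
  from bud_route_step[OF *(1) assms(2,3)] show ?thesis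
  proof
    assume "\<exists>k'\<le>Suc k1. bud_route c V w x k'"
    then obtain k' where "k' \<le> Suc k1" "bud_route c V w x k'" by blast
    then show ?thesis using * unfolding root_route_def by (intro exI[of _ "k' + k2"]) auto
  next
    assume "w = Root \<and> (\<exists>s. \<exists>k'\<le>Suc k1. cross_route c V x s k')"
    then show ?thesis using assms(3) unfolding root_route_def by (intro exI[of _ 0]) auto
  qed
qed

text \<open>Along the ray the route merely changes its end; stepping off at the foot turns it into a
  route through the root, stepping onto the bud into a route through the bud.\<close>

lemma ray_route_step:
  assumes "ray_route V u v k" "(v, w) \<in> edges c" "w \<in> V"
  shows "\<exists>k'\<le>Suc k. route c V u w k'"
  using assms(2)
proof (cases rule: edges_cases)
  case (up_root x s)
  then have "root_route c V u 0" "root_route c V w 1"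
    using assms by (cases u; auto simp: root_route_def segment_refl)+
  then show ?thesis unfolding route_def by (metis One_nat_def add_0 le_add1 plus_1_eq_Suc)
next
  case (down_root x s)
  then obtain i where "u = Node x s i" "segment V x s i 0" "k = gap i 0" using assms by (cases u) auto
  then have "root_route c V u (Suc k)" "root_route c V w 0"
    using assms down_root by (auto simp: root_route_def segment_sym gap_def)
  then show ?thesis unfolding route_def by (metis add.right_neutral order_refl)
next
  case (up x s j)
  then obtain i where i: "u = Node x s i" "segment V x s i j" "k = gap i j" using assms by (cases u) auto
  then have "segment V x s i (Suc j)"
    using assms up by (meson segment_step segment_trans segment_verts)
  then have "ray_route V u w (gap i (Suc j))" using up i by simp
  then show ?thesis using i unfolding route_def by (intro exI[of _ "gap i (Suc j)"]) (auto simp: gap_def)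
next
  case (down x s j)
  then obtain i where i: "u = Node x s i" "segment V x s i (Suc j)" "k = gap i (Suc j)" using assms by (cases u) auto
  then have "segment V x s i j"
    using assms down by (meson segment_step segment_trans segment_verts segment_sym)
  then have "ray_route V u w (gap i j)" using down i by simp
  then show ?thesis using i unfolding route_def by (intro exI[of _ "gap i j"]) (auto simp: gap_def)
next
  case (to_bud x s j)
  then obtain i where i: "u = Node x s i" "segment V x s i j" "k = gap i j" using assms by (cases u) auto
  then have "bud_route c V u x (Suc k)" "bud_route c V w x 0"
    using to_bud assms by auto
  then show ?thesis unfolding route_def by (metis add.right_neutral order_refl)
next
  case (from_bud x s j)
  then have "bud_route c V u x 0" "bud_route c V w x 1"
    using assms by (cases u; auto simp: segment_refl gap_def)+
  then show ?thesis unfolding route_def by (metis One_nat_def add_0 le_add1 plus_1_eq_Suc)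
qed

text \<open>
  The length of a shortest route increases by at most one along an edge, so no walk is
  shorter than the shortest route.
\<close>

lemma route_step:
  assumes "route c V u v k" "(v, w) \<in> edges c" "w \<in> V"
  shows "\<exists>k'\<le>Suc k. route c V u w k'"
  using assms(1) unfolding route_def
proof (elim disjE exE conjE)
  fix x k1 k2
  assume *: "bud_route c V u x k1" "bud_route c V v x k2" "k = k1 + k2"
  from bud_route_step[OF *(2) assms(2,3)]
  show "\<exists>k'\<le>Suc k. ray_route V u w k' \<or>
    (\<exists>x k1 k2. bud_route c V u x k1 \<and> bud_route c V w x k2 \<and> k' = k1 + k2) \<or>
    (\<exists>k1 k2. root_route c V u k1 \<and> root_route c V w k2 \<and> k' = k1 + k2)"
  proof
    assume "\<exists>k'\<le>Suc k2. bud_route c V w x k'"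
    then obtain k' where "k' \<le> Suc k2" "bud_route c V w x k'" by blast
    then show ?thesis using * by (intro exI[of _ "k1 + k'"]) auto
  next
    assume w: "w = Root \<and> (\<exists>s. \<exists>k'\<le>Suc k2. cross_route c V x s k')"
    then obtain s k' where k': "k' \<le> Suc k2" "cross_route c V x s k'" by blast
    then have "root_route c V u (k1 + k')" using * unfolding root_route_def by blast
    moreover have "root_route c V w 0" using w assms(3) by (auto simp: root_route_def)
    ultimately show ?thesis using * k' by (intro exI[of _ "k1 + k'"]) auto
  qed
next
  fix k1 k2
  assume *: "root_route c V u k1" "root_route c V v k2" "k = k1 + k2"
  from root_route_step[OF *(2) assms(2,3)] obtain k' where "k' \<le> Suc k2" "root_route c V w k'" by blast
  then show "\<exists>k'\<le>Suc k. ray_route V u w k' \<or>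
    (\<exists>x k1 k2. bud_route c V u x k1 \<and> bud_route c V w x k2 \<and> k' = k1 + k2) \<or>
    (\<exists>k1 k2. root_route c V u k1 \<and> root_route c V w k2 \<and> k' = k1 + k2)"
    using * by (intro exI[of _ "k1 + k'"]) auto
qed (use ray_route_step[OF _ assms(2,3)] in \<open>auto simp: route_def\<close>)

lemma walk_in_route:
  "walk_in (edges c) V u v l \<Longrightarrow> \<exists>k\<le>l. route c V u v k"
proof (induction l arbitrary: v)
  case 0
  then show ?case by (auto simp: walk_in_0 route_refl)
next
  case (Suc l)
  then obtain w k where "k \<le> l" "route c V u w k" "(w, v) \<in> edges c" "v \<in> V"
    unfolding walk_in_Suc by blast
  from route_step[OF this(2-)] \<open>k \<le> l\<close> show ?case by (meson Suc_le_mono order_trans)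
qed

lemma Least_walk_in_eq_route:
  "(LEAST l. walk_in (edges c) V u v l) = (LEAST l. route c V u v l)"
proof (cases "\<exists>l. walk_in (edges c) V u v l")
  case True
  then have "\<exists>l. route c V u v l" using walk_in_route by blast
  show ?thesis
  proof (rule Least_equality)
    show "walk_in (edges c) V u v (LEAST l. route c V u v l)"
      using LeastI_ex[OF \<open>\<exists>l. route c V u v l\<close>] by (rule route_walk)
    show "(LEAST l. route c V u v l) \<le> l" if "walk_in (edges c) V u v l" for l
      using walk_in_route[OF that] by (meson Least_le order_trans)
  qed
next
  \<comment> \<open>Without any walk both predicates are constantly false, so even the unspecified
    values of \<open>LEAST\<close> coincide.\<close>
  case False
  then have "\<nexists>l. route c V u v l" using route_walk by blast
  with False show ?thesis by simp
qed

section \<open>Counting the possible distances\<close>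

text \<open>Whatever \<open>V\<close> is, the least \<open>k\<close> with \<open>P V k\<close> lies in a fixed set of \<open>m\<close> or fewer numbers.\<close>

definition few_values :: "nat \<Rightarrow> (vert set \<Rightarrow> nat \<Rightarrow> bool) \<Rightarrow> bool" where
  "few_values m P \<longleftrightarrow> (\<exists>C. finite C \<and> card C \<le> m \<and> (\<forall>V k. P V k \<longrightarrow> (\<exists>k'\<le>k. k' \<in> C \<and> P V k')))"

lemma few_valuesI:
  assumes "finite C" "card C \<le> m" "\<And>V k. P V k \<Longrightarrow> \<exists>k'\<le>k. k' \<in> C \<and> P V k'"
  shows "few_values m P"
  unfolding few_values_def using assms by blast

lemma few_values_Least:
  assumes "few_values m P"
  obtains C where "finite C" "card C \<le> m" "\<And>V k. P V k \<Longrightarrow> (LEAST k. P V k) \<in> C"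
proof -
  obtain C where C: "finite C" "card C \<le> m" "\<And>V k. P V k \<Longrightarrow> \<exists>k'\<le>k. k' \<in> C \<and> P V k'"
    using assms unfolding few_values_def by blast
  show thesis
  proof (rule that[OF C(1,2)])
    fix V k assume "P V k"
    then have "P V (LEAST k. P V k)" by (rule LeastI)
    from C(3)[OF this] obtain k' where "k' \<le> (LEAST k. P V k)" "k' \<in> C" "P V k'" by blast
    then show "(LEAST k. P V k) \<in> C" by (metis Least_le le_antisym)
  qed
qed

definition attached :: "(nat \<Rightarrow> nat \<Rightarrow> nat) \<Rightarrow> nat \<Rightarrow> nat set" where
  "attached c x = {s. c x s \<noteq> 0}"

lemma cross_route_iff:
  "cross_route c V x s k \<longleftrightarrow> s \<in> attached c x \<and> Root \<in> V \<and> Bud x \<in> V \<and>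
    segment V x s 0 (c x s - 1) \<and> k = Suc (c x s)"
  unfolding cross_route_def attached_def by (cases "c x s") auto

lemma segment_join_right: "segment V x s i j \<Longrightarrow> segment V x s k j \<Longrightarrow> segment V x s i k"
  using segment_sym segment_trans by blast

lemma segment_join_left: "segment V x s j i \<Longrightarrow> segment V x s j k \<Longrightarrow> segment V x s i k"
  using segment_sym segment_trans by blast

text \<open>From a bud there is one value for each joint. From a vertex on a joined ray the stem is
  one more candidate, but it replaces the detour that returns down the same ray, so the count
  remains \<open>n + 1\<close>.\<close>

lemma few_root_routes:
  assumes "\<And>x. finite (attached c x)" "\<And>x. card (attached c x) \<le> Suc n"
  shows "few_values (Suc n) (\<lambda>V. root_route c V u)"
proof (cases u)
  case Root
  show ?thesis
    by (rule few_valuesI[of "{0}"]) (use Root in \<open>auto simp: root_route_def\<close>)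
next
  case (Bud x)
  show ?thesis
  proof (rule few_valuesI[of "(\<lambda>s. Suc (c x s)) ` attached c x"])
    show "card ((\<lambda>s. Suc (c x s)) ` attached c x) \<le> Suc n"
      using card_image_le[OF assms(1)] assms(2) order_trans by blast
  qed (use assms(1) Bud in \<open>auto simp: root_route_def cross_route_iff\<close>)
next
  case (Node x s j)
  show ?thesis
  proof (cases "c x s")
    case 0
    then show ?thesis
      by (intro few_valuesI[of "{Suc j}"]) (use Node in \<open>auto simp: root_route_def\<close>)
  next
    case (Suc v)
    then have s: "s \<in> attached c x" by (simp add: attached_def)
    let ?C = "(\<lambda>t. Suc (gap j v) + Suc (c x t)) ` (attached c x - {s})"
    show ?thesis
    proof (rule few_valuesI[of "insert (Suc j) ?C"])
      have "card ?C \<le> n"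
        using card_image_le[of "attached c x - {s}"] assms s
        by (metis card_Diff_singleton diff_le_mono diff_Suc_1 finite_Diff order_trans)
      then show "card (insert (Suc j) ?C) \<le> Suc n"
        using assms(1) by (simp add: card_insert_if)
    next
      fix V k assume k: "root_route c V u k"
      then consider "stem_route V u k"
        | t where "bud_route c V u x (Suc (gap j v))" "cross_route c V x t (Suc (c x t))"
           "k = Suc (gap j v) + Suc (c x t)"
        using Node Suc unfolding root_route_def by (auto simp: cross_route_iff)
      then show "\<exists>k'\<le>k. k' \<in> insert (Suc j) ?C \<and> root_route c V u k'"
      proof cases
        case 1
        then show ?thesis using k Node by auto
      next
        case (2 t)
        show ?thesis
        proof (cases "t = s")
          case True
          \<comment> \<open>The segments from the joint down to \<open>j\<close> and down to 0 lie
            on one ray, so together they contain the stem of \<open>u\<close>.\<close>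
          then have "stem_route V u (Suc j)" "Suc j \<le> k"
            using 2 Suc Node by (auto simp: cross_route_iff gap_def intro: segment_join_right)
          then show ?thesis by (auto simp: root_route_def)
        next
          case False
          then show ?thesis using 2 k by (auto simp: cross_route_iff)
        qed
      qed
    qed (use assms in auto)
  qed
qed

text \<open>If the ray of the vertex is joined, the direct way replaces the walk to the root down
  that same ray. At most \<open>n + 1\<close> values arise; \<open>2 * n + 1\<close> is the bound
  shared with two ray vertices.\<close>

lemma few_routes_Bud_Node:
  assumes "finite (attached c x)" "card (attached c x) \<le> Suc n"
  shows "few_values (2 * n + 1) (\<lambda>V. route c V (Bud x) (Node x t j))"
proof (cases "c x t")
  case 0
  show ?thesis
  proof (rule few_valuesI[of "(\<lambda>r. Suc (c x r) + Suc j) ` attached c x"])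
    show "card ((\<lambda>r. Suc (c x r) + Suc j) ` attached c x) \<le> 2 * n + 1"
      using card_image_le[OF assms(1), of "\<lambda>r. Suc (c x r) + Suc j"] assms(2) by linarith
    fix V k assume k: "route c V (Bud x) (Node x t j) k"
    then have "k \<in> (\<lambda>r. Suc (c x r) + Suc j) ` attached c x"
      using 0 by (auto simp: route_def root_route_def cross_route_iff)
    with k show "\<exists>k'\<le>k. k' \<in> (\<lambda>r. Suc (c x r) + Suc j) ` attached c x \<and> route c V (Bud x) (Node x t j) k'"
      by blast
  qed (use assms in simp)
next
  case (Suc w)
  then have t: "t \<in> attached c x" by (simp add: attached_def)
  let ?C = "(\<lambda>r. Suc (c x r) + Suc j) ` (attached c x - {t})"
  show ?thesis
  proof (rule few_valuesI[of "insert (Suc (gap j w)) ?C"])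
    have "card ?C \<le> n"
      using card_image_le[of "attached c x - {t}"] assms t
      by (metis card_Diff_singleton diff_le_mono diff_Suc_1 finite_Diff order_trans)
    then show "card (insert (Suc (gap j w)) ?C) \<le> 2 * n + 1"
      using assms(1) by (simp add: card_insert_if)
  next
    fix V k assume k: "route c V (Bud x) (Node x t j) k"
    let ?b = "bud_route c V (Node x t j) x (Suc (gap j w))"
    from k consider "?b" "Suc (gap j w) \<le> k"
      | r where "cross_route c V x r (Suc (c x r))" "stem_route V (Node x t j) (Suc j)"
         "k = Suc (c x r) + Suc j"
      using Suc unfolding route_def root_route_def by (auto simp: cross_route_iff)
    then show "\<exists>k'\<le>k. k' \<in> insert (Suc (gap j w)) ?C \<and> route c V (Bud x) (Node x t j) k'"
    proof cases
      case 1
      then show ?thesis by (intro exI[of _ "Suc (gap j w)"]) (auto simp: route_def)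
    next
      case (2 r)
      show ?thesis
      proof (cases "r = t")
        case True
        then have ?b "Suc (gap j w) \<le> k"
          using 2 Suc by (auto simp: cross_route_iff gap_def intro: segment_join_left)
        then show ?thesis by (intro exI[of _ "Suc (gap j w)"]) (auto simp: route_def)
      next
        case False
        then show ?thesis using 2 k by (auto simp: cross_route_iff)
      qed
    qed
  qed (use assms in auto)
qed

text \<open>\<open>B\<close> holds the connections without a third ray. In \<open>S\<close> the walk
  goes down the stem of the first vertex, up a third ray to the bud and on to the second vertex;
  \<open>T\<close> is the reverse. The largest bound arises for two vertices on one joined ray: one
  value in \<open>B\<close> and up to \<open>n\<close> in each of \<open>S\<close> and
  \<open>T\<close>. On two different joined rays \<open>B\<close> has two values, but at most
  \<open>n - 1\<close> third rays remain.\<close>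

lemma few_routes_Node_Node:
  assumes fin: "finite (attached c x)" and card: "card (attached c x) \<le> Suc n"
  shows "few_values (2 * n + 1) (\<lambda>V. route c V (Node x s i) (Node x t j))"
proof -
  let ?u = "Node x s i" and ?v = "Node x t j"
  define K where "K = attached c x - {s, t}"
  define d e where "d = Suc (gap i (c x s - 1))" and "e = Suc (gap j (c x t - 1))"
  define B where "B = (if s = t then {gap i j} else insert (Suc i + Suc j)
    (if s \<in> attached c x \<and> t \<in> attached c x then {d + e} else {}))"
  define S where "S = (if t \<in> attached c x then (\<lambda>r. Suc i + (e + Suc (c x r))) ` K else {})"
  define T where "T = (if s \<in> attached c x then (\<lambda>r. d + Suc (c x r) + Suc j) ` K else {})"
  have finK: "finite K" using fin by (simp add: K_def)
  have bud_u: "bud_route c V ?u y k \<longleftrightarrow> y = x \<and> s \<in> attached c x \<and> Bud x \<in> V \<and> segment V x s i (c x s - 1) \<and> k = d" for V y k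
    by (cases "c x s") (auto simp: attached_def d_def)
  have bud_v: "bud_route c V ?v y k \<longleftrightarrow> y = x \<and> t \<in> attached c x \<and> Bud x \<in> V \<and> segment V x t j (c x t - 1) \<and> k = e" for V y k
    by (cases "c x t") (auto simp: attached_def e_def)
  have cardST: "card S \<le> (if t \<in> attached c x then card K else 0)" "card T \<le> (if s \<in> attached c x then card K else 0)"
    using card_image_le[OF finK] by (auto simp: S_def T_def)
  have cardK: "card K + card (attached c x \<inter> {s, t}) \<le> Suc n"
    using card card_Int_Diff[OF fin, of "{s, t}"] by (simp add: K_def)
  have cardB: "card B \<le> (if s = t \<or> s \<notin> attached c x \<or> t \<notin> attached c x then 1 else 2)"
    unfolding B_def by (auto simp: card_insert_if)
  have "card (attached c x \<inter> {s, t}) = (if s = t then of_bool (s \<in> attached c x) else of_bool (s \<in> attached c x) + of_bool (t \<in> attached c x))"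
    by (auto simp: Int_insert_right)
  then have "card B + card S + card T \<le> 2 * n + 1"
    using cardST cardK cardB by (auto split: if_splits)
  then have card_le: "card (B \<union> S \<union> T) \<le> 2 * n + 1"
    using card_Un_le[of "B \<union> S" T] card_Un_le[of B S] by linarith
  show ?thesis
  proof (rule few_valuesI[OF _ card_le])
    show "finite (B \<union> S \<union> T)" using finK by (auto simp: B_def S_def T_def)
    fix V k assume k: "route c V ?u ?v k"
    \<comment> \<open>On a common ray two stems overlap, and the segment between the vertices lies
      in \<open>V\<close> and is shorter. The fact \<open>bb\<close> below does the same for two
      walks to the bud.\<close>
    have ss: "\<exists>k'\<le>k. k' \<in> B \<and> route c V ?u ?v k'"
      if "stem_route V ?u k1" "stem_route V ?v k2" "k1 + k2 \<le> k" for k1 k2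
    proof (cases "s = t")
      case True
      then have "route c V ?u ?v (gap i j)" "gap i j \<le> k"
        using that by (auto simp: route_def gap_def intro: segment_join_left)
      then show ?thesis using True by (auto simp: B_def)
    next
      case False
      have "route c V ?u ?v (k1 + k2)" using that by (auto simp: route_def root_route_def)
      then show ?thesis using that False by (intro exI[of _ "k1 + k2"]) (auto simp: B_def)
    qed
    have bb: "\<exists>k'\<le>k. k' \<in> B \<and> route c V ?u ?v k'"
      if "bud_route c V ?u y k1" "bud_route c V ?v z k2" "k1 + k2 \<le> k" for y z k1 k2
    proof (cases "s = t")
      case True
      then have "route c V ?u ?v (gap i j)" "gap i j \<le> k"
        using that unfolding bud_u bud_v by (auto simp: route_def gap_def d_def e_def intro: segment_join_right)
      then show ?thesis using True by (auto simp: B_def)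
    next
      case False
      have "route c V ?u ?v (k1 + k2)" using that unfolding route_def bud_u bud_v by blast
      then show ?thesis using that False unfolding bud_u bud_v by (intro exI[of _ "k1 + k2"]) (auto simp: B_def)
    qed
    from k consider "ray_route V ?u ?v k"
      | y k1 k2 where "bud_route c V ?u y k1" "bud_route c V ?v y k2" "k = k1 + k2"
      | k1 k2 where "stem_route V ?u k1" "stem_route V ?v k2" "k = k1 + k2"
      | r k1 k2 m where "stem_route V ?u k1" "bud_route c V ?v x k2" "cross_route c V x r m" "k = k1 + (k2 + m)"
      | r k1 k2 m where "bud_route c V ?u x k1" "cross_route c V x r m" "stem_route V ?v k2" "k = k1 + m + k2"
      | y z k1 k2 m m' where "bud_route c V ?u y k1" "bud_route c V ?v z k2" "k = (k1 + m) + (k2 + m')"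
    proof -
      have u_cases: "stem_route V ?u l \<or> (\<exists>r l1 l2. bud_route c V ?u x l1 \<and> cross_route c V x r l2 \<and> l = l1 + l2)"
        if "root_route c V ?u l" for l using that unfolding root_route_def bud_u by blast
      have v_cases: "stem_route V ?v l \<or> (\<exists>r l1 l2. bud_route c V ?v x l1 \<and> cross_route c V x r l2 \<and> l = l1 + l2)"
        if "root_route c V ?v l" for l using that unfolding root_route_def bud_v by blast
      from k show thesis unfolding route_def
      proof (elim disjE exE conjE)
        fix l l' assume "root_route c V ?u l" "root_route c V ?v l'" "k = l + l'"
        with u_cases[OF this(1)] v_cases[OF this(2)] show thesis
          by (elim disjE exE conjE)
            (rule that(3), assumption, assumption, assumption,
             rule that(4), assumption, assumption, assumption, simp only:,
             rule that(5), assumption, assumption, assumption, simp only:,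
             rule that(6), assumption, assumption, simp only:)
      qed (use that(1,2) in blast)+
    qed
    then have "\<exists>k'\<le>k. k' \<in> B \<union> S \<union> T \<and> route c V ?u ?v k'"
    proof cases
      case 1
      then show ?thesis using k by (auto simp: B_def)
    next
      case 2
      then show ?thesis using bb by blast
    next
      case 3
      then show ?thesis using ss by blast
    next
      case (4 r k1 k2 m)
      \<comment> \<open>Climbing \<open>r = s\<close> undoes the descent, so the first vertex
        reaches the bud directly; with \<open>r = t\<close> the walk climbs to the bud and returns,
        so the stem of the second vertex is shorter. Case 5 is the mirror image.\<close>
      consider "r = s" | "r = t" | "r \<notin> {s, t}" by blast
      then show ?thesis
      proof cases
        case 1
        then have "bud_route c V ?u x d" "d \<le> k1 + m"
          using 4 unfolding bud_u bud_v by (auto simp: cross_route_iff d_def gap_def intro: segment_join_left)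
        then show ?thesis using bb[OF _ 4(2)] 4 by fastforce
      next
        case 2
        then have "stem_route V ?v (Suc j)" "Suc j \<le> k2 + m"
          using 4 unfolding bud_u bud_v by (auto simp: cross_route_iff e_def gap_def intro: segment_join_right)
        then show ?thesis using ss[OF 4(1)] 4 by fastforce
      next
        case 3
        then have "k \<in> S" using 4 unfolding bud_v by (auto simp: cross_route_iff S_def K_def)
        then show ?thesis using k by auto
      qed
    next
      case (5 r k1 k2 m)
      consider "r = s" | "r = t" | "r \<notin> {s, t}" by blast
      then show ?thesis
      proof cases
        case 1
        then have "stem_route V ?u (Suc i)" "Suc i \<le> k1 + m"
          using 5 unfolding bud_u bud_v by (auto simp: cross_route_iff d_def gap_def intro: segment_join_right)
        then show ?thesis using ss[OF _ 5(3)] 5 by fastforce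
      next
        case 2
        then have "bud_route c V ?v x e" "e \<le> k2 + m"
          using 5 unfolding bud_u bud_v by (auto simp: cross_route_iff e_def gap_def intro: segment_join_left)
        then show ?thesis using bb[OF 5(1)] 5 by fastforce
      next
        case 3
        then have "k \<in> T" using 5 unfolding bud_u by (auto simp: cross_route_iff T_def K_def)
        then show ?thesis using k by auto
      qed
    next
      case (6 y z k1 k2 m m')
      \<comment> \<open>Both halves visit the bud, so the trip from the bud to the root and back is
        dropped.\<close>
      then show ?thesis using bb[OF 6(1,2)] by fastforce
    qed
    then show "\<exists>k'\<le>k. k' \<in> B \<union> S \<union> T \<and> route c V ?u ?v k'" .
  qed
qed

fun gadget :: "vert \<Rightarrow> nat option" where
  "gadget Root = None"
| "gadget (Bud x) = Some x"
| "gadget (Node x s j) = Some x"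

lemma few_routes:
  assumes "\<And>x. finite (attached c x)" "\<And>x. card (attached c x) \<le> Suc n"
    and "gadget u = Some x" "gadget v = Some x"
  shows "few_values (2 * n + 1) (\<lambda>V. route c V u v)"
proof (cases u; cases v)
  fix y z assume "u = Bud y" "v = Bud z"
  then show ?thesis using assms(3,4)
    by (intro few_valuesI[of "{0}"]) (auto simp: route_def root_route_def cross_route_def)
next
  fix y z s i assume "u = Node y s i" "v = Bud z"
  then have "(\<lambda>V. route c V u v) = (\<lambda>V. route c V (Bud x) (Node x s i))"
    using assms(3,4) by (auto simp: fun_eq_iff route_sym)
  then show ?thesis using few_routes_Bud_Node assms by metis
qed (use assms few_routes_Bud_Node few_routes_Node_Node in auto)

lemma route_different_gadgets:
  assumes "gadget u = None \<or> gadget v = None \<or> gadget u \<noteq> gadget v"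
  shows "route c V u v k \<longleftrightarrow> (\<exists>k1 k2. root_route c V u k1 \<and> root_route c V v k2 \<and> k = k1 + k2)"
  using assms by (cases u; cases v) (auto simp: route_def root_route_def)

section \<open>Presentations of a graph\<close>

text \<open>Removing cycles only shortens a walk. Hence the minimum over \<open>apath\<close> in the
  distance function equals the minimum over walks, which are the ones that can be built up edge by
  edge.\<close>

lemma (in wf_digraph) apath_length_le:
  assumes "awalk u p v"
  obtains q where "apath u q v" "length q \<le> length p"
proof -
  have "\<exists>q. apath u q v \<and> length q \<le> length p"
    using assms
  proof (induction rule: awalk_to_apath_induct)
    case (path p)
    then show ?case by (auto simp: apath_def)
  next
    case (decomp p q r s)
    then have "p = q @ r @ s"
      using awalk_cyc_decomp_has_prop by fastforce
    with decomp(4) show ?case by (auto intro: order_trans)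
  qed
  with that show thesis by blast
qed

lemma (in pair_wf_digraph) awalk_walk_in:
  "awalk u p v \<Longrightarrow> walk_in (parcs G) (pverts G) u v (length p)"
proof (induction p arbitrary: u)
  case Nil
  then show ?case by (auto simp: awalk_Nil_iff walk_in_0)
next
  case (Cons e p)
  then have e: "e \<in> parcs G" "u = fst e" and "awalk (snd e) p v"
    by (auto simp: awalk_Cons_iff)
  then have "walk_in (parcs G) (pverts G) u (snd e) (Suc 0)"
    by (intro walk_in_edge) (auto intro: arc_fst_in_verts arc_snd_in_verts)
  from walk_in_trans[OF this Cons.IH[OF \<open>awalk (snd e) p v\<close>]] show ?case by simp
qed

lemma (in pair_wf_digraph) walk_in_awalk:
  "walk_in (parcs G) (pverts G) u v l \<Longrightarrow> \<exists>p. awalk u p v \<and> length p = l"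
proof (induction l arbitrary: v)
  case 0
  then show ?case by (auto simp: walk_in_0 awalk_Nil_iff)
next
  case (Suc l)
  then obtain w p where w: "(w, v) \<in> parcs G" "w \<in> pverts G" "v \<in> pverts G" and p: "awalk u p w" "length p = l"
    unfolding walk_in_Suc by blast
  have "awalk w [(w, v)] v" using w by (simp add: awalk_Cons_iff awalk_Nil_iff)
  then have "awalk u (p @ [(w, v)]) v" using p by (blast intro: awalk_appendI)
  with p show ?case by (intro exI[of _ "p @ [(w, v)]"]) simp
qed

lemma (in pair_wf_digraph) Least_apath_eq_walk_in:
  "(LEAST l. \<exists>p. apath u p v \<and> length p = l) = (LEAST l. walk_in (parcs G) (pverts G) u v l)"
proof (cases "\<exists>l. walk_in (parcs G) (pverts G) u v l")
  case True
  let ?l = "LEAST l. walk_in (parcs G) (pverts G) u v l"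
  have "walk_in (parcs G) (pverts G) u v ?l" using True by (rule LeastI_ex)
  then obtain p where p: "awalk u p v" "length p = ?l" using walk_in_awalk by blast
  obtain q where q: "apath u q v" "length q \<le> ?l" using apath_length_le[OF p(1)] p(2) by metis
  have le: "?l \<le> length q'" if "apath u q' v" for q'
    using awalk_walk_in[OF awalkI_apath[OF that]] by (rule Least_le)
  show ?thesis
    by (rule Least_equality) (use q le in \<open>auto intro: antisym\<close>)
next
  case False
  then have "\<nexists>p. apath u p v" using awalk_walk_in awalkI_apath by blast
  with False show ?thesis by simp
qed

lemma distance_function_eq_walk_in:
  assumes "pair_wf_digraph H" "pverts H = UNIV"
  shows "distance_function H (prod_encode (u, v)) = (LEAST l. walk_in (parcs H) UNIV u v l)"
  using pair_wf_digraph.Least_apath_eq_walk_in[OF assms(1), of u v] assms(2)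
  by (simp add: distance_function_def)

lemma walk_in_image:
  assumes "inj \<phi>" "\<And>u v. (\<phi> u, \<phi> v) \<in> F \<longleftrightarrow> (u, v) \<in> E"
  shows "walk_in F (\<phi> ` V) (\<phi> u) (\<phi> v) l \<longleftrightarrow> walk_in E V u v l"
proof (induction l arbitrary: v)
  case 0
  then show ?case using assms(1) by (auto simp: walk_in_0 inj_image_mem_iff dest: injD)
next
  case (Suc l)
  have "walk_in F (\<phi> ` V) (\<phi> u) (\<phi> v) (Suc l) \<longleftrightarrow>
      (\<exists>w. walk_in F (\<phi> ` V) (\<phi> u) (\<phi> w) l \<and> (\<phi> w, \<phi> v) \<in> F \<and> w \<in> V \<and> v \<in> V)"
    using assms(1) by (auto simp: walk_in_Suc inj_image_mem_iff)
  then show ?case using Suc assms(2) by (auto simp: walk_in_Suc)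
qed

text \<open>A labelling of the abstract graph by numbers: presentations are compared through the
  type \<open>vert\<close> instead of with each other. The domain is \<open>UNIV\<close> because the
  gadget graph is infinite.\<close>

definition copy :: "(nat \<Rightarrow> nat \<Rightarrow> nat) \<Rightarrow> (vert \<Rightarrow> nat) \<Rightarrow> nat pair_pre_digraph \<Rightarrow> bool" where
  "copy c \<phi> H \<longleftrightarrow> bij \<phi> \<and> pverts H = UNIV \<and> (\<forall>u v. (\<phi> u, \<phi> v) \<in> parcs H \<longleftrightarrow> (u, v) \<in> edges c)"

lemma copy_bidirected:
  assumes "copy c \<phi> H"
  shows "pair_bidirected_digraph H"
proof -
  have ex: "\<exists>w. v = \<phi> w" for v using assms unfolding copy_def by (metis bij_pointE)
  have "(v, u) \<in> parcs H" if "(u, v) \<in> parcs H" for u v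
    using that assms ex[of u] ex[of v] sym_edges[of c] unfolding copy_def by (auto dest: symD)
  moreover have "(u, u) \<notin> parcs H" for u
    using assms ex[of u] unfolding copy_def by (auto elim!: edges_cases[of w w for w])
  moreover have "pverts H = UNIV" using assms by (simp add: copy_def)
  ultimately show ?thesis
    by unfold_locales (auto simp: symmetric_conv intro!: bexI[of _ "(b, a)" for a b])
qed

lemma distance_function_copy:
  assumes "copy c \<phi> H"
  shows "distance_function H (prod_encode (\<phi> u, \<phi> v)) = (LEAST l. route c UNIV u v l)"
proof -
  have "pair_wf_digraph H"
    using copy_bidirected[OF assms] unfolding pair_bidirected_digraph_def pair_sym_digraph_def by blast
  then have "distance_function H (prod_encode (\<phi> u, \<phi> v)) = (LEAST l. walk_in (parcs H) UNIV (\<phi> u) (\<phi> v) l)"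
    using assms by (intro distance_function_eq_walk_in) (auto simp: copy_def)
  also have "\<dots> = (LEAST l. walk_in (edges c) UNIV u v l)"
    using walk_in_image[of \<phi> "parcs H" "edges c" UNIV u v] assms
    by (simp add: copy_def bij_is_inj bij_is_surj)
  finally show ?thesis by (simp add: Least_walk_in_eq_route)
qed

lemma copy_connected:
  assumes "copy c \<phi> H" "\<And>u v. \<exists>k. route c UNIV u v k"
  shows "Digraph_Component.connected (with_proj H)"
proof -
  interpret pair_bidirected_digraph H using assms(1) by (rule copy_bidirected)
  have univ: "pverts H = UNIV" using assms(1) by (simp add: copy_def)
  show ?thesis
  proof (rule connectedI)
    fix a b assume "a \<in> pverts H" "b \<in> pverts H"
    obtain u v where uv: "a = \<phi> u" "b = \<phi> v"
      using assms(1) unfolding copy_def by (metis bij_pointE)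
    obtain k where "walk_in (edges c) UNIV u v k" using assms(2) route_walk by blast
    then have "walk_in (parcs H) UNIV a b k"
      using walk_in_image[of \<phi> "parcs H" "edges c" UNIV u v] assms(1) uv
      by (simp add: copy_def bij_is_inj bij_is_surj)
    then obtain p where "awalk a p b" using walk_in_awalk univ by metis
    then have "a \<rightarrow>\<^sup>*\<^bsub>with_proj H\<^esub> b" by (auto simp: reachable_awalk)
    then show "a \<rightarrow>\<^sup>*\<^bsub>mk_symmetric (with_proj H)\<^esub> b" by (rule reachable_mk_symmetricI)
  qed (simp add: univ)
qed

lemma copy_digraph_iso:
  assumes "copy c \<phi> G" "copy c \<psi> H"
  shows "digraph_iso (with_proj G) (with_proj H)"
proof -
  define \<theta> where "\<theta> = \<psi> \<circ> inv \<phi>"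
  have bij: "bij \<theta>" unfolding \<theta>_def using assms by (simp add: copy_def bij_comp bij_imp_bij_inv)
  have edge: "(\<theta> a, \<theta> b) \<in> parcs H \<longleftrightarrow> (a, b) \<in> parcs G" for a b
    using assms unfolding copy_def \<theta>_def comp_def by (metis bij_inv_eq_iff)
  interpret pair_bidirected_digraph G using assms(1) by (rule copy_bidirected)
  let ?f = "\<lparr>iso_verts = \<theta>, iso_arcs = map_prod \<theta> \<theta>, iso_head = snd, iso_tail = fst\<rparr>"
  have "digraph_isomorphism ?f"
    unfolding digraph_isomorphism_def using bij
    by (auto intro: wf_digraph_axioms inj_onI simp: bij_is_inj inj_eq)
  moreover have "parcs H = map_prod \<theta> \<theta> ` parcs G"
  proof (intro set_eqI iffI)
    fix e assume "e \<in> parcs H"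
    moreover obtain a b where "e = (\<theta> a, \<theta> b)" using bij by (metis bij_pointE surj_pair)
    ultimately show "e \<in> map_prod \<theta> \<theta> ` parcs G" using edge by force
  qed (use edge in auto)
  then have "with_proj H = app_iso ?f (with_proj G)"
    using assms bij by (auto simp: app_iso_def with_proj_def copy_def bij_is_surj)
  ultimately show ?thesis unfolding digraph_iso_def by blast
qed

text \<open>An isomorphism carries separate maps for vertices and arcs; since tail and head are
  \<open>fst\<close> and \<open>snd\<close> on both sides, the vertex map determines the arc map.
  The image of an infinite vertex set is infinite, so the domain of \<open>H\<close> cannot be a
  finite initial segment.\<close>

lemma digraph_iso_copy:
  assumes "copy c \<phi> G" "digraph_iso (with_proj G) (with_proj H)" "computable_graph H"
  obtains \<psi> where "copy c \<psi> H"
proof -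
  interpret pair_bidirected_digraph G using assms(1) by (rule copy_bidirected)
  obtain f where f: "digraph_isomorphism f" and H: "with_proj H = app_iso f (with_proj G)"
    using assms(2) unfolding digraph_iso_def by blast
  let ?\<theta> = "iso_verts f"
  have univ: "pverts G = UNIV" and bij: "bij \<phi>" using assms(1) by (auto simp: copy_def)
  have vH: "pverts H = range ?\<theta>" and aH: "parcs H = iso_arcs f ` parcs G"
    and ht: "iso_tail f = fst" "iso_head f = snd"
    using H univ unfolding app_iso_def with_proj_def by auto
  have inj: "inj ?\<theta>" using f univ by (simp add: digraph_isomorphism_def)
  have "infinite (range ?\<theta>)" using finite_imageD[OF _ inj] infinite_UNIV_nat by blast
  then have H_univ: "pverts H = UNIV" using assms(3) vH by (auto simp: computable_graph_def)
  have "iso_arcs f (a, b) = (?\<theta> a, ?\<theta> b)" if "(a, b) \<in> parcs G" for a b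
    using f that ht unfolding digraph_isomorphism_def by (metis fst_conv snd_conv prod.collapse)
  then have "parcs H = map_prod ?\<theta> ?\<theta> ` parcs G"
    unfolding aH by (intro image_cong) auto
  then have "(?\<theta> a, ?\<theta> b) \<in> parcs H \<longleftrightarrow> (a, b) \<in> parcs G" for a b
    using inj by (auto dest: injD)
  then have "copy c (?\<theta> \<circ> \<phi>) H"
    using assms(1) inj H_univ vH by (auto simp: copy_def intro: bij_comp bijI)
  then show thesis by (rule that)
qed

lemma copy_relabel:
  assumes "copy c' \<psi> H" "bij \<theta>" "\<And>u v. (u, v) \<in> edges c \<longleftrightarrow> (\<theta> u, \<theta> v) \<in> edges c'"
  shows "copy c (\<psi> \<circ> \<theta>) H"
  using assms by (simp add: copy_def bij_comp)

section \<open>Approximating distances in a computable copy\<close>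

text \<open>Breadth-first search inside \<open>{..<s}\<close>, with the set of visited vertices coded as a bit mask.\<close>

definition reach_step :: "nat rel \<Rightarrow> nat \<Rightarrow> nat \<Rightarrow> nat" where
  "reach_step E s y = (\<Sum>w<s. 2 ^ w * of_bool (w \<in> set_decode y \<or> (\<exists>w'<s. w' \<in> set_decode y \<and> (w', w) \<in> E)))"

definition reach :: "nat rel \<Rightarrow> nat \<Rightarrow> nat \<Rightarrow> nat \<Rightarrow> nat" where
  "reach E a s l = rec_nat (if a < s then 2 ^ a else 0) (\<lambda>m y. reach_step E s y) l"

lemma set_encode_filter: "(\<Sum>w<s. 2 ^ w * of_bool (P w)) = set_encode {w. w < s \<and> P w}"
proof -
  have "(\<Sum>w<s. 2 ^ w * of_bool (P w)) = (\<Sum>w\<in>{w\<in>{..<s}. P w}. (2::nat) ^ w)"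
    by (rule sum.mono_neutral_cong_right) auto
  then show ?thesis by (simp add: set_encode_def)
qed

lemma set_decode_reach_step:
  "set_decode (reach_step E s y) = {w. w < s \<and> (w \<in> set_decode y \<or> (\<exists>w'<s. w' \<in> set_decode y \<and> (w', w) \<in> E))}"
  unfolding reach_step_def set_encode_filter by (rule set_encode_inverse) simp

lemma set_decode_pow2: "set_decode (2 ^ a) = {a}"
  using set_encode_inverse[of "{a}"] by (simp add: set_encode_def)

lemma set_decode_reach: "set_decode (reach E a s l) = {w. \<exists>k\<le>l. walk_in E {..<s} a w k}"
proof (induction l)
  case 0
  then show ?case by (auto simp: reach_def set_decode_pow2 walk_in_0)
next
  case (Suc l)
  have "reach E a s (Suc l) = reach_step E s (reach E a s l)" by (simp add: reach_def)
  moreover have "(\<exists>k\<le>Suc l. walk_in E {..<s} a w k) \<longleftrightarrow>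
     w < s \<and> ((\<exists>k\<le>l. walk_in E {..<s} a w k) \<or> (\<exists>w'<s. (\<exists>k\<le>l. walk_in E {..<s} a w' k) \<and> (w', w) \<in> E))" for w
  proof
    assume "\<exists>k\<le>Suc l. walk_in E {..<s} a w k"
    then obtain k where k: "k \<le> Suc l" "walk_in E {..<s} a w k" by blast
    show "w < s \<and> ((\<exists>k\<le>l. walk_in E {..<s} a w k) \<or> (\<exists>w'<s. (\<exists>k\<le>l. walk_in E {..<s} a w' k) \<and> (w', w) \<in> E))"
      using k walk_in_verts[OF k(2)] by (cases k) (auto simp: walk_in_Suc)
  next
    assume "w < s \<and> ((\<exists>k\<le>l. walk_in E {..<s} a w k) \<or> (\<exists>w'<s. (\<exists>k\<le>l. walk_in E {..<s} a w' k) \<and> (w', w) \<in> E))"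
    then show "\<exists>k\<le>Suc l. walk_in E {..<s} a w k"
    proof (elim conjE disjE exE)
      fix w' k assume "w < s" "w' < s" "k \<le> l" "walk_in E {..<s} a w' k" "(w', w) \<in> E"
      then show ?thesis by (intro exI[of _ "Suc k"]) (auto simp: walk_in_Suc)
    qed (auto intro: le_SucI)
  qed
  ultimately show ?case by (auto simp: set_decode_reach_step Suc)
qed

lemma recursive_reach:
  assumes E: "computable2 (\<lambda>u v. of_bool ((u, v) \<in> E))"
    and "recursive k A" "recursive k B" "recursive k C"
  shows "recursive k (\<lambda>xs. reach E (A xs) (B xs) (C xs))"
proof -
  have E': "decidable k (\<lambda>xs. (F xs, G xs) \<in> E)" if "recursive k F" "recursive k G" for k F G
    using recursive_comp2[OF E[unfolded computable2_iff_recursive] that] .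
  have "recursive 2 (\<lambda>xs. reach_step E (xs ! 0) (xs ! 1))"
    unfolding reach_step_def
    by (intro recursive_intros decidable_set_decode E') auto
  from recursive_comp2[OF this] have step: "recursive k (\<lambda>xs. reach_step E (F xs) (G xs))"
    if "recursive k F" "recursive k G" for k F G using that .
  have "recursive 3 (\<lambda>xs. rec_nat (if xs ! 0 < xs ! 1 then 2 ^ (xs ! 0) else 0)
      (\<lambda>m y. reach_step E (xs ! 1) y) (xs ! 2))"
    by (rule recursive_primrec) (intro recursive_intros step; simp)+
  then have "recursive 3 (\<lambda>xs. reach E (xs ! 0) (xs ! 1) (xs ! 2))"
    by (simp add: reach_def)
  from recursive_comp3[OF this assms(2-)] show ?thesis .
qed

text \<open>An upward closed predicate fails exactly below its least witness, so counting failures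
  turns minimisation into a bounded sum.\<close>

lemma sum_not_eq_Least:
  fixes P :: "nat \<Rightarrow> bool"
  assumes "P s" "\<And>k l. P k \<Longrightarrow> k \<le> l \<Longrightarrow> P l"
  shows "(\<Sum>l<s. of_bool (\<not> P l) :: nat) = (LEAST l. P l)"
proof -
  have "\<not> P l \<longleftrightarrow> l < (LEAST l. P l)" for l
    using assms(2) LeastI[of P, OF assms(1)] not_less_Least[of l P] by (meson not_less)
  moreover have "(LEAST l. P l) \<le> s" using assms(1) by (rule Least_le)
  then have "{..<s} \<inter> {l. l < (LEAST l. P l)} = {..<LEAST l. P l}" by auto
  ultimately show ?thesis by (simp add: of_bool_def sum.If_cases)
qed

text \<open>One number bounds both the vertices and the length, so a single search finds it. The
  approximation starts here because a provisional value given earlier could cost an additional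
  change.\<close>

definition first_joined :: "nat rel \<Rightarrow> nat \<Rightarrow> nat \<Rightarrow> nat" where
  "first_joined E a b = (LEAST s. \<exists>k\<le>s. walk_in E {..<s} a b k)"

lemma computable2_stage_distance:
  assumes E: "computable2 (\<lambda>u v. of_bool ((u, v) \<in> E))"
    and joined: "\<And>a b. \<exists>s. \<exists>k\<le>s. walk_in E {..<s} a b k"
  shows "computable2 (\<lambda>z s. case prod_decode z of (a, b) \<Rightarrow>
    LEAST k. walk_in E {..<first_joined E a b + s} a b k)"
proof -
  define D where "D a b s = (\<Sum>l<s. of_bool (b \<notin> set_decode (reach E a s l)) :: nat)" for a b s
  have first: "first_joined E a b = (LEAST s. b \<in> set_decode (reach E a s s))" for a b
    by (simp add: first_joined_def set_decode_reach)
  have "D a b (first_joined E a b + s) = (LEAST k. walk_in E {..<first_joined E a b + s} a b k)" for a b s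
  proof -
    let ?s = "first_joined E a b + s"
    from LeastI_ex[OF joined] obtain k where k: "k \<le> first_joined E a b" "walk_in E {..<first_joined E a b} a b k"
      unfolding first_joined_def by blast
    then have "walk_in E {..<?s} a b k" by (auto elim: walk_in_mono)
    then have P: "\<exists>k\<le>?s. walk_in E {..<?s} a b k" using k by (meson trans_le_add1)
    have "D a b ?s = (LEAST l. \<exists>k\<le>l. walk_in E {..<?s} a b k)"
      unfolding D_def set_decode_reach mem_Collect_eq
      by (rule sum_not_eq_Least) (use P in \<open>blast intro: order_trans\<close>)+
    also have "\<dots> = (LEAST k. walk_in E {..<?s} a b k)"
    proof (rule Least_equality)
      show "\<exists>k\<le>LEAST k. walk_in E {..<?s} a b k. walk_in E {..<?s} a b k"
        using P by (blast intro: LeastI)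
      show "(LEAST k. walk_in E {..<?s} a b k) \<le> y" if "\<exists>k\<le>y. walk_in E {..<?s} a b k" for y
        using that by (blast intro: order_trans Least_le)
    qed
    finally show ?thesis .
  qed
  moreover have "recursive 2 (\<lambda>xs. D (fst (prod_decode (xs ! 0))) (snd (prod_decode (xs ! 0)))
      (first_joined E (fst (prod_decode (xs ! 0))) (snd (prod_decode (xs ! 0))) + xs ! 1))"
  proof -
    have "recursive 3 (\<lambda>xs. D (xs ! 0) (xs ! 1) (xs ! 2))"
      unfolding D_def by (intro recursive_intros decidable_set_decode recursive_reach[OF E]) auto
    from recursive_comp3[OF this] have D: "recursive k (\<lambda>xs. D (A xs) (B xs) (C xs))"
      if "recursive k A" "recursive k B" "recursive k C" for k A B C using that .
    have "recursive 2 (\<lambda>xs. first_joined E (xs ! 0) (xs ! 1))"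
      unfolding first
      by (intro recursive_Mu recursive_intros decidable_set_decode recursive_reach[OF E])
        (use joined in \<open>auto simp: set_decode_reach\<close>)
    from recursive_comp2[OF this] have F: "recursive k (\<lambda>xs. first_joined E (A xs) (B xs))"
      if "recursive k A" "recursive k B" for k A B using that .
    show ?thesis
      by (intro D F recursive_intros recursive_fst_prod_decode recursive_snd_prod_decode) auto
  qed
  ultimately show ?thesis by (simp add: computable2_iff_recursive case_prod_beta)
qed

section \<open>From few possible values to few changes\<close>

definition changes :: "(nat \<Rightarrow> nat) \<Rightarrow> nat set" where
  "changes h = {s. h s \<noteq> h (Suc s)}"

text \<open>Each change is sent to the value right after it. For a descending sequence this is
  injective and misses \<open>h 0\<close>, so \<open>m + 1\<close> values leave room for only
  \<open>m\<close> changes.\<close>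

lemma changes_bounded_range:
  assumes "\<And>s. h (Suc s) \<le> h s" "\<And>s. h s \<in> C" "finite C" "card C \<le> Suc m"
  shows "finite (changes h) \<and> card (changes h) \<le> m"
proof -
  have mono: "h t \<le> h s" if "s \<le> t" for s t using assms(1) that by (rule lift_Suc_antimono_le)
  have less: "h (Suc s) < h s" if "s \<in> changes h" for s
    using assms(1)[of s] that by (auto simp: changes_def)
  have "inj_on (\<lambda>s. h (Suc s)) (changes h)"
  proof (rule linorder_inj_onI')
    fix s t assume "s \<in> changes h" "t \<in> changes h" "s < t"
    then have "h (Suc t) < h t" "h t \<le> h (Suc s)" using less mono by auto
    then show "h (Suc s) \<noteq> h (Suc t)" by simp
  qed
  moreover have sub: "(\<lambda>s. h (Suc s)) ` changes h \<subseteq> C - {h 0}"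
    using less mono[of 0] assms(2) by (metis (no_types, lifting) DiffI image_subsetI le0 leD singletonD)
  moreover have "finite (C - {h 0})" "card (C - {h 0}) \<le> m"
    using assms by auto
  ultimately show ?thesis by (meson card_inj_on_le inj_on_finite le_trans)
qed

lemma changes_add:
  assumes "finite (changes f) \<and> card (changes f) \<le> m" "finite (changes g) \<and> card (changes g) \<le> n"
  shows "finite (changes (\<lambda>s. f s + g s)) \<and> card (changes (\<lambda>s. f s + g s)) \<le> m + n"
proof -
  have sub: "changes (\<lambda>s. f s + g s) \<subseteq> changes f \<union> changes g" by (auto simp: changes_def)
  have fin: "finite (changes f \<union> changes g)" using assms by simp
  have "card (changes f \<union> changes g) \<le> m + n"
    using card_Un_le[of "changes f" "changes g"] assms by linarith
  then show ?thesis using card_mono[OF fin sub] finite_subset[OF sub fin] by linarith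
qed

lemma Least_add:
  fixes P Q :: "nat \<Rightarrow> bool"
  assumes "P a" "Q b"
  shows "(LEAST k. \<exists>k1 k2. P k1 \<and> Q k2 \<and> k = k1 + k2) = (LEAST k. P k) + (LEAST k. Q k)"
proof (rule Least_equality)
  show "\<exists>k1 k2. P k1 \<and> Q k2 \<and> (LEAST k. P k) + (LEAST k. Q k) = k1 + k2"
    using LeastI[of P, OF assms(1)] LeastI[of Q, OF assms(2)] by blast
  show "(LEAST k. P k) + (LEAST k. Q k) \<le> y" if "\<exists>k1 k2. P k1 \<and> Q k2 \<and> y = k1 + k2" for y
    using that by (auto intro!: add_mono Least_le)
qed

lemma root_route_mono:
  assumes "root_route c V u k" "V \<subseteq> W"
  shows "root_route c W u k"
proof -
  have seg: "segment W x s i j" if "segment V x s i j" for x s i j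
    using that assms(2) by (auto simp: segment_def)
  have "stem_route W u k" if "stem_route V u k" for k
    using that assms(2) seg by (cases u) auto
  moreover have "bud_route c W u x k" if "bud_route c V u x k" for x k
    using that assms(2) seg by (cases u) auto
  moreover have "cross_route c W x s k" if "cross_route c V x s k" for x s k
    using that assms(2) seg by (auto simp: cross_route_def)
  ultimately show ?thesis using assms(1) unfolding root_route_def by blast
qed

text \<open>Between different gadgets the candidate sums may number up to \<open>(n + 1)^2\<close>,
  so counting values would not do. There the changes of the two distances to the root are counted
  separately, \<open>n\<close> for each, and added.\<close>

lemma few_changes:
  assumes fin: "\<And>x. finite (attached c x)" and card: "\<And>x. card (attached c x) \<le> Suc n"
    and mono: "\<And>s t. s \<le> t \<Longrightarrow> V s \<subseteq> V t"
    and joined: "\<exists>k. route c (V 0) u v k"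
  defines "h \<equiv> \<lambda>s. LEAST k. route c (V s) u v k"
  shows "finite (changes h) \<and> card (changes h) \<le> 2 * n"
proof (cases "gadget u \<noteq> None \<and> gadget u = gadget v")
  case True
  have ex: "\<exists>k. route c (V s) u v k" for s
    using joined mono[of 0 s] by (meson le0 route_walk walk_in_mono walk_in_route)
  have "few_values (2 * n + 1) (\<lambda>V. route c V u v)"
    using True few_routes[OF fin card] by fastforce
  then obtain C where C: "finite C" "card C \<le> 2 * n + 1" "\<And>V k. route c V u v k \<Longrightarrow> (LEAST k. route c V u v k) \<in> C"
    using few_values_Least by blast
  show ?thesis
  proof (rule changes_bounded_range)
    fix s
    from LeastI_ex[OF ex] have "route c (V s) u v (h s)" by (simp add: h_def)
    then have "walk_in (edges c) (V (Suc s)) u v (h s)"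
      using mono[of s "Suc s"] by (auto intro: walk_in_mono route_walk)
    then obtain k where "k \<le> h s" "route c (V (Suc s)) u v k" using walk_in_route by blast
    then show "h (Suc s) \<le> h s" unfolding h_def by (meson Least_le le_trans)
    show "h s \<in> C" unfolding h_def using ex C(3) by blast
  qed (use C in auto)
next
  case False
  have route: "route c V u v k \<longleftrightarrow> (\<exists>k1 k2. root_route c V u k1 \<and> root_route c V v k2 \<and> k = k1 + k2)" for V k
    using False by (intro route_different_gadgets) auto
  \<comment> \<open>Here being joined means that both vertices already reach the root, so both
    summands are genuine minima from stage 0 on.\<close>
  from joined obtain a b where ab: "root_route c (V 0) u a" "root_route c (V 0) v b"
    unfolding route by blast
  have ab': "root_route c (V s) u a" "root_route c (V s) v b" for s
    using ab mono[of 0 s] root_route_mono by blast+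
  have few: "finite (changes (\<lambda>s. LEAST k. root_route c (V s) w k)) \<and>
      card (changes (\<lambda>s. LEAST k. root_route c (V s) w k)) \<le> n" if ex: "\<And>s. root_route c (V s) w l" for w l
  proof -
    obtain C where C: "finite C" "card C \<le> Suc n" "\<And>V k. root_route c V w k \<Longrightarrow> (LEAST k. root_route c V w k) \<in> C"
      using few_values_Least[OF few_root_routes[OF fin card]] by blast
    show ?thesis
    proof (rule changes_bounded_range)
      fix s
      have "root_route c (V s) w (LEAST k. root_route c (V s) w k)" using ex by (rule LeastI)
      then have "root_route c (V (Suc s)) w (LEAST k. root_route c (V s) w k)"
        by (rule root_route_mono) (simp add: mono)
      then show "(LEAST k. root_route c (V (Suc s)) w k) \<le> (LEAST k. root_route c (V s) w k)"
        by (rule Least_le)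
      show "(LEAST k. root_route c (V s) w k) \<in> C" using ex C(3) by blast
    qed (use C in auto)
  qed
  have "h = (\<lambda>s. (LEAST k. root_route c (V s) u k) + (LEAST k. root_route c (V s) v k))"
    unfolding h_def route using Least_add ab' by (intro ext) blast
  then show ?thesis using changes_add[OF few few, OF ab'(1) ab'(2)] by (simp add: mult_2)
qed

lemma copy_approximable:
  assumes copy: "copy c \<phi> H" and H: "computable_graph H"
    and fin: "\<And>x. finite (attached c x)" and card: "\<And>x. card (attached c x) \<le> Suc n"
    and joined: "\<And>u v. \<exists>k. route c UNIV u v k"
  shows "approximable_from_above (2 * n) (distance_function H)"
proof -
  let ?E = "parcs H"
  have bij: "bij \<phi>" using copy by (simp add: copy_def)
  have surj: "\<exists>u. a = \<phi> u" for a using bij by (metis bij_pointE)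
  \<comment> \<open>The abstract vertices whose labels have appeared by stage
    \<open>s\<close>.\<close>
  define V where "V s = \<phi> -` {..<s}" for s :: nat
  have img: "\<phi> ` V s = {..<s}" for s
    using bij by (simp add: V_def bij_is_surj)
  have walk: "walk_in ?E {..<s} (\<phi> u) (\<phi> v) k \<longleftrightarrow> walk_in (edges c) (V s) u v k" for s u v k
    using walk_in_image[of \<phi> ?E "edges c" "V s" u v k] copy img by (simp add: copy_def bij_is_inj)
  have J: "\<exists>s0. \<forall>s\<ge>s0. walk_in (edges c) (V s) u v k" if w: "walk_in (edges c) UNIV u v k" for u v k
  proof -
    obtain W where W: "finite W" "walk_in (edges c) W u v k"
      using walk_in_finite[OF w] by blast
    obtain s0 where "\<forall>a\<in>\<phi> ` W. a < s0" using W(1) finite_nat_set_iff_bounded by blast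
    then have "W \<subseteq> V s" if "s \<ge> s0" for s using that by (auto simp: V_def)
    then show ?thesis using W(2) walk_in_mono by metis
  qed
  have joinedE: "\<exists>s. \<exists>k\<le>s. walk_in ?E {..<s} a b k" for a b
  proof -
    obtain u v where uv: "a = \<phi> u" "b = \<phi> v" using surj by meson
    obtain k where "walk_in (edges c) UNIV u v k" using joined route_walk by blast
    then obtain s0 where "\<forall>s\<ge>s0. walk_in (edges c) (V s) u v k" using J by blast
    then show ?thesis unfolding uv walk by (intro exI[of _ "max s0 k"] exI[of _ k]) auto
  qed
  define g where "g z s = (case prod_decode z of (a, b) \<Rightarrow>
    LEAST k. walk_in ?E {..<first_joined ?E a b + s} a b k)" for z s
  have "computable2 g"
    unfolding g_def using H by (intro computable2_stage_distance joinedE) (simp add: computable_graph_def)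
  moreover have "(\<lambda>s. g z s) \<longlonglongrightarrow> distance_function H z \<and> (\<forall>s. g z (Suc s) \<le> g z s) \<and>
     finite (changes (g z)) \<and> card (changes (g z)) \<le> 2 * n" for z
  proof -
    obtain a b where ab: "prod_decode z = (a, b)" by fastforce
    obtain u v where uv: "a = \<phi> u" "b = \<phi> v" using surj by meson
    have z: "z = prod_encode (\<phi> u, \<phi> v)" using ab uv by (metis prod_decode_inverse)
    define t where "t = first_joined ?E a b"
    have t: "first_joined ?E (\<phi> u) (\<phi> v) = t" by (simp add: t_def uv)
    have g': "g z s = (LEAST k. walk_in (edges c) (V (t + s)) u v k)" for s
    proof -
      have "g z s = (LEAST k. walk_in ?E {..<t + s} (\<phi> u) (\<phi> v) k)"
        by (simp only: g_def ab uv prod.case t)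
      also have "\<dots> = (LEAST k. walk_in (edges c) (V (t + s)) u v k)"
        by (rule arg_cong[where f = Least]) (rule ext, rule walk)
      finally show ?thesis .
    qed
    then have g: "g z s = (LEAST k. route c (V (t + s)) u v k)" for s
      by (simp only: Least_walk_in_eq_route)
    obtain k where "walk_in ?E {..<t} a b k"
      using LeastI_ex[OF joinedE[of a b]] by (auto simp: t_def first_joined_def)
    then have base: "walk_in (edges c) (V t) u v k" by (simp add: uv walk)
    have Vmono: "V (t + s) \<subseteq> V (t + s')" if "s \<le> s'" for s s' using that by (auto simp: V_def)
    have ch: "finite (changes (g z)) \<and> card (changes (g z)) \<le> 2 * n"
      using few_changes[of c n "\<lambda>s. V (t + s)" u v, OF fin card] walk_in_route[OF base] Vmono
      by (auto simp: g[abs_def])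
    have walk_s: "walk_in (edges c) (V (t + s)) u v (g z s)" for s
      unfolding g' by (rule LeastI, rule walk_in_mono[OF base]) (use Vmono[of 0 s] in simp)
    have dec: "g z (Suc s) \<le> g z s" for s
    proof -
      have "walk_in (edges c) (V (t + Suc s)) u v (g z s)"
        by (rule walk_in_mono[OF walk_s Vmono]) simp
      then show ?thesis unfolding g'[of "Suc s"] by (rule Least_le)
    qed
    have dist: "distance_function H z = (LEAST k. walk_in (edges c) UNIV u v k)"
      unfolding z using distance_function_copy[OF copy] by (simp add: Least_walk_in_eq_route)
    let ?d = "distance_function H z"
    obtain k' where "route c UNIV u v k'" using joined by blast
    then have "walk_in (edges c) UNIV u v ?d"
      unfolding dist by (rule LeastI[of "walk_in (edges c) UNIV u v", OF route_walk])
    then obtain s0 where s0: "\<forall>s\<ge>s0. walk_in (edges c) (V s) u v ?d" using J by blast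
    \<comment> \<open>From the stage at which a shortest walk is visible the approximation is at
      most the distance; it is never below, as a walk in a subgraph is a walk in the graph.\<close>
    have "g z s = ?d" if "s \<ge> s0" for s
    proof (rule antisym)
      have "walk_in (edges c) (V (t + s)) u v ?d" using s0 that by simp
      then show "g z s \<le> ?d" unfolding g' by (rule Least_le)
      have "walk_in (edges c) UNIV u v (g z s)" using walk_in_mono[OF walk_s] by blast
      then show "?d \<le> g z s" unfolding dist by (rule Least_le)
    qed
    then have "eventually (\<lambda>s. g z s = ?d) sequentially" by (auto simp: eventually_sequentially)
    then have "(\<lambda>s. g z s) \<longlonglongrightarrow> ?d" by (rule tendsto_eventually)
    with ch dec show ?thesis by blast
  qed
  ultimately show ?thesis unfolding approximable_from_above_def changes_def by blast
qed

section \<open>Isomorphisms between gadget families\<close>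

text \<open>Applied twice: to the rays of a gadget, sorted by joint height, and to the gadgets,
  sorted by shape.\<close>

lemma bij_from_fibres:
  assumes "\<And>k. \<exists>h. bij_betw h {s. f s = k} {s. g s = k}"
  obtains \<sigma> where "bij \<sigma>" "\<And>s. g (\<sigma> s) = f s"
proof -
  from assms obtain h where h: "\<And>k. bij_betw (h k) {s. f s = k} {s. g s = k}" by metis
  define \<sigma> where "\<sigma> s = h (f s) s" for s
  have g: "g (\<sigma> s) = f s" for s
    using bij_betw_apply[OF h[of "f s"], of s] by (simp add: \<sigma>_def)
  have "inj \<sigma>"
  proof (rule injI)
    fix s t assume eq: "\<sigma> s = \<sigma> t"
    then have "f s = f t" using g by metis
    then show "s = t"
      using eq bij_betw_imp_inj_on[OF h[of "f s"]] by (auto simp: \<sigma>_def dest: inj_onD)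
  qed
  moreover have "surj \<sigma>"
    unfolding surj_def
  proof
    fix t
    obtain s where "f s = g t" "h (g t) s = t"
      using bij_betw_imp_surj_on[OF h[of "g t"]] by force
    then show "\<exists>s. t = \<sigma> s" unfolding \<sigma>_def by metis
  qed
  ultimately show thesis using that g by (simp add: bij_def)
qed

lemma bij_betw_infinite_nat:
  fixes A B :: "nat set"
  assumes "infinite A" "infinite B"
  shows "\<exists>h. bij_betw h A B"
  using bij_betw_trans[OF bij_betw_inv_into[OF bij_enumerate[OF assms(1)]] bij_enumerate[OF assms(2)]]
  by blast

text \<open>The set of joint heights; in a \<open>tame\<close> family it determines a gadget up to a
  permutation of its rays.\<close>

definition shape :: "(nat \<Rightarrow> nat \<Rightarrow> nat) \<Rightarrow> nat \<Rightarrow> nat set" where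
  "shape c x = {v. \<exists>s. c x s = Suc v}"

definition tame :: "nat \<Rightarrow> (nat \<Rightarrow> nat \<Rightarrow> nat) \<Rightarrow> bool" where
  "tame n c \<longleftrightarrow> (\<forall>x. attached c x \<noteq> {} \<and> finite (attached c x) \<and> card (attached c x) \<le> Suc n \<and>
     inj_on (c x) (attached c x))"

definition admissible :: "nat \<Rightarrow> nat set \<Rightarrow> bool" where
  "admissible n S \<longleftrightarrow> S \<noteq> {} \<and> finite S \<and> card S \<le> Suc n"

text \<open>With infinitely many gadgets of each admissible shape, two such families are matched by
  cardinality alone.\<close>

definition universal :: "nat \<Rightarrow> (nat \<Rightarrow> nat \<Rightarrow> nat) \<Rightarrow> bool" where
  "universal n c \<longleftrightarrow> tame n c \<and> (\<forall>S. admissible n S \<longrightarrow> infinite {x. shape c x = S})"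

lemma shape_eq_image: "shape c x = (\<lambda>s. c x s - 1) ` attached c x"
  unfolding shape_def attached_def by (auto simp: image_iff) (metis One_nat_def diff_Suc_1 zero_less_Suc)

lemma tame_admissible: "tame n c \<Longrightarrow> admissible n (shape c x)"
  unfolding tame_def admissible_def shape_eq_image
  using card_image_le[of "attached c x" "\<lambda>s. c x s - 1"] by (auto intro: order_trans)

text \<open>By injectivity each occupied height belongs to exactly one ray, and on both sides the
  unjoined rays form an infinite set.\<close>

lemma rays_bij:
  assumes "tame n c" "tame n c'" "shape c x = shape c' y"
  obtains \<sigma> where "bij \<sigma>" "\<And>s. c' y (\<sigma> s) = c x s"
proof (rule bij_from_fibres[of "c x" "c' y"])
  fix k
  show "\<exists>h. bij_betw h {s. c x s = k} {s. c' y s = k}"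
  proof (cases k)
    case 0
    have "infinite {s. d z s = 0}" if "tame n d" for d z
    proof -
      have "{s. d z s = 0} = UNIV - attached d z" by (auto simp: attached_def)
      moreover have "infinite (UNIV - attached d z)"
        using that Diff_infinite_finite[of "attached d z" UNIV] by (simp add: tame_def)
      ultimately show ?thesis by simp
    qed
    then show ?thesis using bij_betw_infinite_nat 0 assms by metis
  next
    case (Suc v)
    have one: "\<exists>s. {s. d z s = Suc v} = {s}" if d: "tame n d" "v \<in> shape d z" for d z
    proof -
      obtain s where s: "d z s = Suc v" using d(2) by (auto simp: shape_def)
      have "inj_on (d z) (attached d z)" using d(1) by (simp add: tame_def)
      then have "t = s" if "d z t = Suc v" for t
        by (rule inj_onD) (use that s in \<open>auto simp: attached_def\<close>)
      with s have "{r. d z r = Suc v} = {s}" by blast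
      then show ?thesis by blast
    qed
    show ?thesis
    proof (cases "v \<in> shape c x")
      case True
      then obtain s t where "{s. c x s = Suc v} = {s}" "{s. c' y s = Suc v} = {t}"
        using one assms by metis
      then show ?thesis using Suc by (intro exI[of _ "\<lambda>_. t"]) (auto simp: bij_betw_def)
    next
      case False
      then have "{s. c x s = Suc v} = {}" "{s. c' y s = Suc v} = {}"
        using assms(3) by (auto simp: shape_def)
      then show ?thesis using Suc by (auto simp: bij_betw_def)
    qed
  qed
qed (rule that)

lemma arc_simps [simp]:
  "\<not> arc c u Root" "\<not> arc c (Bud x) u" "\<not> arc c Root (Bud x)"
  "arc c Root (Node x s j) \<longleftrightarrow> j = 0"
  "arc c (Node x s i) (Node y t j) \<longleftrightarrow> x = y \<and> s = t \<and> j = Suc i"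
  "arc c (Node x s j) (Bud y) \<longleftrightarrow> x = y \<and> c x s = Suc j"
  by (auto elim: arc.cases intro: arc.intros)

text \<open>The matching is made by choice. In general it cannot be computable: distances over the
  catalogue are computable, while those over the interleaved family compute
  \<open>f\<close>.\<close>

lemma universal_iso:
  assumes "universal n c" "universal n c'"
  obtains \<theta> where "bij \<theta>" "\<And>u v. (u, v) \<in> edges c \<longleftrightarrow> (\<theta> u, \<theta> v) \<in> edges c'"
proof -
  have tame: "tame n c" "tame n c'" using assms by (auto simp: universal_def)
  have "\<exists>h. bij_betw h {x. shape c x = S} {x. shape c' x = S}" for S
  proof (cases "admissible n S")
    case True
    then show ?thesis using bij_betw_infinite_nat assms unfolding universal_def by metis
  next
    case False
    then have "{x. shape c x = S} = {}" "{x. shape c' x = S} = {}"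
      using tame tame_admissible by blast+
    then show ?thesis by (auto simp: bij_betw_def)
  qed
  then obtain \<pi> where \<pi>: "bij \<pi>" "\<And>x. shape c' (\<pi> x) = shape c x"
    using bij_from_fibres[of "shape c" "shape c'"] by metis
  have "\<exists>\<sigma>. bij \<sigma> \<and> (\<forall>s. c' (\<pi> x) (\<sigma> s) = c x s)" for x
    using rays_bij[OF tame, of x "\<pi> x"] \<pi>(2) by metis
  then obtain \<sigma> where \<sigma>: "\<And>x. bij (\<sigma> x)" "\<And>x s. c' (\<pi> x) (\<sigma> x s) = c x s" by metis
  define \<theta> where "\<theta> u = (case u of Root \<Rightarrow> Root | Bud x \<Rightarrow> Bud (\<pi> x) | Node x s j \<Rightarrow> Node (\<pi> x) (\<sigma> x s) j)" for u
  have \<theta>: "\<theta> Root = Root" "\<theta> (Bud x) = Bud (\<pi> x)" "\<theta> (Node x s j) = Node (\<pi> x) (\<sigma> x s) j" for x s j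
    by (simp_all add: \<theta>_def)
  have inj: "\<pi> x = \<pi> y \<longleftrightarrow> x = y" "\<sigma> x s = \<sigma> x t \<longleftrightarrow> s = t" for x y s t
    using \<pi>(1) \<sigma>(1) by (auto simp: bij_def inj_eq)
  have "\<theta> u = \<theta> v \<Longrightarrow> u = v" for u v
    by (cases u; cases v) (auto simp: \<theta> inj)
  then have "inj \<theta>" by (rule injI)
  moreover have "\<exists>u. \<theta> u = v" for v
  proof (cases v)
    case Root then show ?thesis using \<theta> by blast
  next
    case (Bud y)
    obtain x where "y = \<pi> x" using \<pi>(1) by (metis bij_pointE)
    then show ?thesis using Bud \<theta> by metis
  next
    case (Node y t j)
    obtain x where x: "y = \<pi> x" using \<pi>(1) by (metis bij_pointE)
    obtain s where "t = \<sigma> x s" using \<sigma>(1) by (metis bij_pointE)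
    then show ?thesis using Node \<theta> x by metis
  qed
  then have "surj \<theta>" unfolding surj_def by metis
  moreover have "arc c u v \<longleftrightarrow> arc c' (\<theta> u) (\<theta> v)" for u v
    by (cases u; cases v) (auto simp: \<theta> inj \<sigma>(2))
  ultimately show thesis using that[of \<theta>] by (simp add: bij_def edges_def)
qed

section \<open>The computable catalogue and the gadgets that track an approximation\<close>

text \<open>The second component of \<open>x\<close> is padding, which repeats each shape infinitely
  often. Codes of inadmissible sets fall back to \<open>{0}\<close>, itself admissible for every
  \<open>n\<close>.\<close>

definition catalogue_shape :: "nat \<Rightarrow> nat \<Rightarrow> nat set" where
  "catalogue_shape n x = (let S = set_decode (fst (prod_decode x)) in if admissible n S then S else {0})"

text \<open>Ray number and joint height coincide, which makes the heights distinct at once.\<close>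

definition catalogue :: "nat \<Rightarrow> nat \<Rightarrow> nat \<Rightarrow> nat" where
  "catalogue n x s = (if s \<in> catalogue_shape n x then Suc s else 0)"

lemma admissible_catalogue_shape: "admissible n (catalogue_shape n x)"
  by (auto simp: catalogue_shape_def Let_def admissible_def)

lemma attached_catalogue: "attached (catalogue n) x = catalogue_shape n x"
  by (simp add: attached_def catalogue_def)

lemma shape_catalogue: "shape (catalogue n) x = catalogue_shape n x"
  by (auto simp: shape_def catalogue_def)

lemma infinite_catalogue_shape:
  assumes "admissible n S" shows "infinite {x. catalogue_shape n x = S}"
proof -
  have "prod_encode (set_encode S, k) \<in> {x. catalogue_shape n x = S}" for k
    using assms by (simp add: catalogue_shape_def admissible_def)
  then have "range (\<lambda>k. prod_encode (set_encode S, k)) \<subseteq> {x. catalogue_shape n x = S}" by blast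
  moreover have "infinite (range (\<lambda>k. prod_encode (set_encode S, k)))"
    by (rule range_inj_infinite) (auto intro: injI)
  ultimately show ?thesis by (rule infinite_super)
qed

lemma tame_catalogue: "tame n (catalogue n)"
  using admissible_catalogue_shape[of n]
  by (auto simp: tame_def attached_catalogue admissible_def catalogue_def inj_on_def)

lemma universal_catalogue: "universal n (catalogue n)"
  by (simp add: universal_def tame_catalogue shape_catalogue infinite_catalogue_shape)

definition interleave :: "(nat \<Rightarrow> nat \<Rightarrow> nat) \<Rightarrow> (nat \<Rightarrow> nat \<Rightarrow> nat) \<Rightarrow> nat \<Rightarrow> nat \<Rightarrow> nat" where
  "interleave c c' x = (if even x then c (x div 2) else c' (x div 2))"

lemma attached_interleave:
  "attached (interleave c c') x = (if even x then attached c (x div 2) else attached c' (x div 2))"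
  by (simp add: attached_def interleave_def)

lemma shape_interleave:
  "shape (interleave c c') x = (if even x then shape c (x div 2) else shape c' (x div 2))"
  by (simp add: shape_def interleave_def)

text \<open>The odd positions alone supply every admissible shape infinitely often, whatever tame
  family occupies the even ones.\<close>

lemma universal_interleave:
  assumes "tame n c" "universal n c'"
  shows "universal n (interleave c c')"
  unfolding universal_def
proof (intro conjI allI impI)
  show "tame n (interleave c c')"
    using assms unfolding universal_def tame_def attached_interleave by (auto simp: interleave_def)
  fix S assume "admissible n S"
  then have "infinite {x. shape c' x = S}" using assms(2) by (simp add: universal_def)
  then have "infinite ((\<lambda>x. 2 * x + 1) ` {x. shape c' x = S})"
    using finite_imageD[of "\<lambda>x. 2 * x + 1" "{x. shape c' x = S}"] by (auto simp: inj_on_def)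
  moreover have "(\<lambda>x. 2 * x + 1) ` {x. shape c' x = S} \<subseteq> {x. shape (interleave c c') x = S}"
    by (auto simp: shape_interleave)
  ultimately show "infinite {x. shape (interleave c c') x = S}" by (meson infinite_super)
qed

definition tracking :: "(nat \<Rightarrow> nat \<Rightarrow> nat) \<Rightarrow> nat \<Rightarrow> nat \<Rightarrow> nat" where
  "tracking g x s = (if s = 0 \<or> g x s \<noteq> g x (s - 1) then Suc (g x s) else 0)"

definition low :: "(nat \<Rightarrow> nat \<Rightarrow> nat) \<Rightarrow> nat \<Rightarrow> nat" where
  "low c x = (LEAST v. v \<in> shape c x)"

lemma attached_tracking: "attached (tracking g) x = insert 0 (Suc ` changes (g x))"
proof (intro set_eqI)
  fix s show "s \<in> attached (tracking g) x \<longleftrightarrow> s \<in> insert 0 (Suc ` changes (g x))"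
    by (cases s) (auto simp: attached_def tracking_def changes_def)
qed

text \<open>Stage 0 and at most \<open>n\<close> changes give at most \<open>n + 1\<close> joints.
  The values descend, and strictly so at a change, so later joints are strictly lower.\<close>

lemma tame_tracking:
  assumes "\<And>x s. g x (Suc s) \<le> g x s" "\<And>x. finite (changes (g x)) \<and> card (changes (g x)) \<le> n"
  shows "tame n (tracking g)"
  unfolding tame_def
proof (intro allI conjI)
  fix x
  show "attached (tracking g) x \<noteq> {}" "finite (attached (tracking g) x)"
    using assms(2) by (auto simp: attached_tracking)
  show "card (attached (tracking g) x) \<le> Suc n"
    using assms(2) by (simp add: attached_tracking card_insert_if card_image)
  have mono: "g x t \<le> g x s" if "s \<le> t" for s t using assms(1) that by (rule lift_Suc_antimono_le)
  show "inj_on (tracking g x) (attached (tracking g) x)"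
  proof (rule linorder_inj_onI')
    fix s t assume st: "s \<in> attached (tracking g) x" "t \<in> attached (tracking g) x" "s < t"
    then obtain t' where t': "t = Suc t'" "t' \<in> changes (g x)" by (auto simp: attached_tracking)
    then have "g x t < g x t'" "g x t' \<le> g x s"
      using assms(1)[where x = x and s = t'] mono[of s t'] st by (auto simp: changes_def)
    moreover have "tracking g x s = Suc (g x s)" "tracking g x t = Suc (g x t)"
      using st by (auto simp: attached_def tracking_def split: if_splits)
    ultimately show "tracking g x s \<noteq> tracking g x t" by simp
  qed
qed

lemma low_tracking:
  assumes "\<And>s. g x (Suc s) \<le> g x s" "g x \<longlonglongrightarrow> f x"
  shows "low (tracking g) x = f x"
  unfolding low_def
proof (rule Least_equality)
  have mono: "g x t \<le> g x s" if "s \<le> t" for s t using assms(1) that by (rule lift_Suc_antimono_le)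
  have "\<forall>\<^sub>F s in sequentially. g x s \<in> {f x}"
    using assms(2) by (rule topological_tendstoD) (auto simp: open_discrete)
  then obtain N where N: "\<And>s. s \<ge> N \<Longrightarrow> g x s = f x" by (auto simp: eventually_sequentially)
  \<comment> \<open>A stage without a change repeats a value that already has a joint, so every
    value, and with it the limit, is a joint height.\<close>
  have "g x s \<in> shape (tracking g) x" for s
  proof (induction s)
    case 0
    show ?case by (auto simp: shape_def tracking_def)
  next
    case (Suc s)
    show ?case
    proof (cases "g x (Suc s) = g x s")
      case False
      then have "tracking g x (Suc s) = Suc (g x (Suc s))" by (simp add: tracking_def)
      then show ?thesis unfolding shape_def by blast
    qed (use Suc in simp)
  qed
  with N show "f x \<in> shape (tracking g) x" by (metis order_refl)
  show "f x \<le> v" if v: "v \<in> shape (tracking g) x" for v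
  proof -
    obtain s where "v = g x s" using v by (auto simp: shape_def tracking_def split: if_splits)
    then show ?thesis using mono[of s "max s N"] N[of "max s N"] by simp
  qed
qed

lemma low_interleave:
  "low (interleave c c') x = (if even x then low c (x div 2) else low c' (x div 2))"
  by (simp add: low_def shape_interleave)

text \<open>
  Explicit distances. The arguments \<open>m\<close> and \<open>m'\<close> stand for the lowest joints of the gadgets of the two
  vertices; keeping them as parameters gives a total function of the oracle answers. If the gadgets
  coincide then so do \<open>m\<close> and \<open>m'\<close>.
\<close>

definition stretch :: "(nat \<Rightarrow> nat \<Rightarrow> nat) \<Rightarrow> nat \<Rightarrow> nat \<Rightarrow> nat \<Rightarrow> nat" where
  "stretch c x s j = Suc (gap j (c x s - 1))"

fun root_dist :: "(nat \<Rightarrow> nat \<Rightarrow> nat) \<Rightarrow> nat \<Rightarrow> vert \<Rightarrow> nat" where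
  "root_dist c m Root = 0"
| "root_dist c m (Bud x) = m + 2"
| "root_dist c m (Node x s j) = (if c x s = 0 then Suc j else min (Suc j) (stretch c x s j + (m + 2)))"

fun vert_dist :: "(nat \<Rightarrow> nat \<Rightarrow> nat) \<Rightarrow> nat \<Rightarrow> nat \<Rightarrow> vert \<Rightarrow> vert \<Rightarrow> nat" where
  "vert_dist c m m' (Bud x) (Bud y) = (if x = y then 0 else m + 2 + (m' + 2))"
| "vert_dist c m m' (Bud x) (Node y t j) = (if x = y \<and> c y t \<noteq> 0
    then min (stretch c y t j) (m + 2 + root_dist c m' (Node y t j)) else m + 2 + root_dist c m' (Node y t j))"
| "vert_dist c m m' (Node x s i) (Bud y) = (if x = y \<and> c x s \<noteq> 0
    then min (stretch c x s i) (root_dist c m (Node x s i) + (m' + 2)) else root_dist c m (Node x s i) + (m' + 2))"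
| "vert_dist c m m' (Node x s i) (Node y t j) = (let d = root_dist c m (Node x s i) + root_dist c m' (Node y t j) in
    if x = y \<and> s = t then min (gap i j) d
    else if x = y \<and> c x s \<noteq> 0 \<and> c y t \<noteq> 0 then min (stretch c x s i + stretch c y t j) d else d)"
| "vert_dist c m m' u v = root_dist c m u + root_dist c m' v"

text \<open>The default 0 at the root agrees with \<open>code_x 0\<close>, so codes need no special
  case; \<open>root_dist\<close> is 0 at the root for every \<open>m\<close>.\<close>

definition gadget_index :: "vert \<Rightarrow> nat" where
  "gadget_index u = (case gadget u of None \<Rightarrow> 0 | Some x \<Rightarrow> x)"

text \<open>Existence and minimality in one predicate, so that minima of unions and of sums combine
  as \<open>min\<close> and \<open>+\<close>.\<close>

definition is_least :: "(nat \<Rightarrow> bool) \<Rightarrow> nat \<Rightarrow> bool" where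
  "is_least P m \<longleftrightarrow> P m \<and> (\<forall>k. P k \<longrightarrow> m \<le> k)"

lemma is_least_Least: "is_least P m \<Longrightarrow> (LEAST k. P k) = m"
  by (auto simp: is_least_def intro: Least_equality)

lemma is_least_disj: "is_least P m \<Longrightarrow> is_least Q k \<Longrightarrow> is_least (\<lambda>i. P i \<or> Q i) (min m k)"
  by (auto simp: is_least_def min_def)

lemma is_least_add: "is_least P m \<Longrightarrow> is_least Q k \<Longrightarrow> is_least (\<lambda>i. \<exists>a b. P a \<and> Q b \<and> i = a + b) (m + k)"
  by (auto simp: is_least_def intro: add_mono)

lemma segment_UNIV [simp]: "segment UNIV x s i j"
  by (simp add: segment_def)

lemma is_least_cross:
  assumes "tame n c" shows "is_least (\<lambda>k. \<exists>s. cross_route c UNIV x s k) (low c x + 2)"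
proof -
  have "\<exists>v. v \<in> shape c x" using tame_admissible[OF assms] by (auto simp: admissible_def)
  then have "low c x \<in> shape c x" unfolding low_def by (rule LeastI_ex)
  moreover have "low c x \<le> v" if "v \<in> shape c x" for v unfolding low_def using that by (rule Least_le)
  moreover have "(\<exists>s. cross_route c UNIV x s k) \<longleftrightarrow> (\<exists>v\<in>shape c x. k = v + 2)" for k
    by (auto simp: cross_route_def shape_def)
  ultimately show ?thesis by (auto simp: is_least_def)
qed

lemma bud_route_UNIV:
  "bud_route c UNIV (Node y s j) x k \<longleftrightarrow> y = x \<and> c x s \<noteq> 0 \<and> k = stretch c x s j"
  by (cases "c x s") (auto simp: stretch_def)

lemma is_least_root_route:
  assumes "tame n c" shows "is_least (root_route c UNIV u) (root_dist c (low c (gadget_index u)) u)"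
proof (cases u)
  case Root
  then show ?thesis by (auto simp: is_least_def root_route_def)
next
  case (Bud x)
  have "root_route c UNIV (Bud x) = (\<lambda>k. \<exists>s. cross_route c UNIV x s k)"
    by (auto simp: root_route_def fun_eq_iff)
  then show ?thesis using is_least_cross[OF assms, of x] Bud by (simp add: gadget_index_def)
next
  case (Node x s j)
  have stem: "is_least (\<lambda>k. k = i) i" for i :: nat by (simp add: is_least_def)
  show ?thesis
  proof (cases "c x s = 0")
    case True
    then have "root_route c UNIV u = (\<lambda>k. k = Suc j)"
      using Node by (auto simp: root_route_def fun_eq_iff bud_route_UNIV simp del: bud_route.simps)
    then show ?thesis using Node True stem by simp
  next
    case False
    then have "root_route c UNIV u = (\<lambda>k. k = Suc j \<or> (\<exists>a b. a = stretch c x s j \<and> (\<exists>r. cross_route c UNIV x r b) \<and> k = a + b))"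
      using Node by (auto simp: root_route_def fun_eq_iff bud_route_UNIV simp del: bud_route.simps)
    then show ?thesis
      using is_least_disj[OF stem[of "Suc j"] is_least_add[OF stem[of "stretch c x s j"] is_least_cross[OF assms, of x]]]
        Node False
      by (simp add: gadget_index_def)
  qed
qed

lemma is_least_route:
  assumes "tame n c"
  shows "is_least (route c UNIV u v) (vert_dist c (low c (gadget_index u)) (low c (gadget_index v)) u v)"
proof -
  define m where "m w = low c (gadget_index w)" for w
  define R where "R k \<longleftrightarrow> (\<exists>k1 k2. root_route c UNIV u k1 \<and> root_route c UNIV v k2 \<and> k = k1 + k2)" for k
  have R: "is_least R (root_dist c (m u) u + root_dist c (m v) v)"
    unfolding R_def m_def by (intro is_least_add is_least_root_route[OF assms])
  have const: "is_least (\<lambda>k. k = i) i" for i :: nat by (simp add: is_least_def)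
  have route: "route c UNIV u v k \<longleftrightarrow> ray_route UNIV u v k \<or>
    (\<exists>x k1 k2. bud_route c UNIV u x k1 \<and> bud_route c UNIV v x k2 \<and> k = k1 + k2) \<or> R k" for k
    by (simp add: route_def R_def)
  have "is_least (route c UNIV u v) (vert_dist c (m u) (m v) u v)"
  proof (cases "gadget u = None \<or> gadget v = None \<or> gadget u \<noteq> gadget v")
    case True
    then have "route c UNIV u v = R" by (auto simp: fun_eq_iff R_def route_different_gadgets)
    then show ?thesis using R True by (cases u; cases v) (auto simp: Let_def)
  next
    case False
    show ?thesis
    proof (cases u; cases v)
      fix x y assume u: "u = Bud x" and v: "v = Bud y"
      then have "route c UNIV u v 0" using False by (auto intro: route_refl)
      then show ?thesis using u v False by (simp add: is_least_def)
    next
      fix x y t j assume u: "u = Bud x" and v: "v = Node y t j"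
      then have "x = y" using False by simp
      then have "route c UNIV u v = (\<lambda>k. (c x t \<noteq> 0 \<and> k = stretch c x t j) \<or> R k)"
        unfolding fun_eq_iff route using u v by (auto simp: bud_route_UNIV simp del: bud_route.simps(3))
      then show ?thesis
        using is_least_disj[OF const[of "stretch c x t j"] R] R u v \<open>x = y\<close> by (cases "c x t = 0") simp_all
    next
      fix x s i y assume u: "u = Node x s i" and v: "v = Bud y"
      then have "x = y" using False by simp
      then have "route c UNIV u v = (\<lambda>k. (c x s \<noteq> 0 \<and> k = stretch c x s i) \<or> R k)"
        unfolding fun_eq_iff route using u v by (auto simp: bud_route_UNIV simp del: bud_route.simps(3))
      then show ?thesis
        using is_least_disj[OF const[of "stretch c x s i"] R] R u v \<open>x = y\<close> by (cases "c x s = 0") simp_all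
    next
      fix x s i y t j assume u: "u = Node x s i" and v: "v = Node y t j"
      then have "x = y" using False by simp
      show ?thesis
      proof (cases "s = t")
        case True
        \<comment> \<open>By the triangle inequality the way through the bud never beats the direct
          way on a common ray; hence \<open>vert_dist\<close> has no bud term in this case.\<close>
        have "is_least (\<lambda>k. k = gap i j \<or> (c x s \<noteq> 0 \<and> k = stretch c x s i + stretch c x s j)) (gap i j)"
          by (auto simp: is_least_def stretch_def gap_def)
        moreover have "route c UNIV u v = (\<lambda>k. (k = gap i j \<or> (c x s \<noteq> 0 \<and> k = stretch c x s i + stretch c x s j)) \<or> R k)"
          unfolding fun_eq_iff route using u v True \<open>x = y\<close> by (auto simp: bud_route_UNIV simp del: bud_route.simps(3))
        moreover have "vert_dist c (m u) (m v) u v = min (gap i j) (root_dist c (m u) u + root_dist c (m v) v)"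
          using u v True \<open>x = y\<close> by (simp add: Let_def)
        ultimately show ?thesis using is_least_disj[OF _ R] by metis
      next
        case False
        then have "route c UNIV u v = (\<lambda>k. (c x s \<noteq> 0 \<and> c x t \<noteq> 0 \<and> k = stretch c x s i + stretch c x t j) \<or> R k)"
          unfolding fun_eq_iff route using u v \<open>x = y\<close> by (auto simp: bud_route_UNIV simp del: bud_route.simps(3))
        then show ?thesis
          using is_least_disj[OF const[of "stretch c x s i + stretch c x t j"] R] R u v \<open>x = y\<close> False
          by (cases "c x s = 0 \<or> c x t = 0") (auto simp: Let_def)
      qed
    qed (use False in auto)
  qed
  then show ?thesis by (simp add: m_def)
qed

section \<open>Encoding and reductions\<close>

text \<open>Code 0 is the root. Otherwise \<open>a - 1\<close> codes the gadget and a number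
  \<open>z\<close>, where \<open>z = 0\<close> marks the bud and \<open>z - 1\<close> codes ray and
  height. Truncated subtraction keeps the projections total, with arbitrary values where a
  coordinate has no meaning.\<close>

definition code_x :: "nat \<Rightarrow> nat" where "code_x a = fst (prod_decode (a - 1))"
definition code_z :: "nat \<Rightarrow> nat" where "code_z a = snd (prod_decode (a - 1))"
definition code_s :: "nat \<Rightarrow> nat" where "code_s a = fst (prod_decode (code_z a - 1))"
definition code_j :: "nat \<Rightarrow> nat" where "code_j a = snd (prod_decode (code_z a - 1))"

lemma recursive_code:
  assumes "recursive k A"
  shows "recursive k (\<lambda>xs. code_x (A xs))" "recursive k (\<lambda>xs. code_z (A xs))"
    "recursive k (\<lambda>xs. code_s (A xs))" "recursive k (\<lambda>xs. code_j (A xs))"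
  unfolding code_x_def code_s_def code_j_def code_z_def
  by (intro recursive_fst_prod_decode recursive_snd_prod_decode recursive_diff recursive_const assms)+

definition vert_decode :: "nat \<Rightarrow> vert" where
  "vert_decode a = (if a = 0 then Root else if code_z a = 0 then Bud (code_x a)
     else Node (code_x a) (code_s a) (code_j a))"

fun vert_encode :: "vert \<Rightarrow> nat" where
  "vert_encode Root = 0"
| "vert_encode (Bud x) = Suc (prod_encode (x, 0))"
| "vert_encode (Node x s j) = Suc (prod_encode (x, Suc (prod_encode (s, j))))"

lemma vert_encode_inverse: "vert_decode (vert_encode u) = u"
  by (cases u) (simp_all add: vert_decode_def code_x_def code_z_def code_s_def code_j_def)

lemma vert_decode_inverse: "vert_encode (vert_decode a) = a"
proof (cases a)
  case (Suc b)
  show ?thesis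
  proof (cases "code_z a")
    case 0
    then show ?thesis using Suc prod_decode_inverse[of b]
      by (cases "prod_decode b") (simp add: vert_decode_def code_x_def code_z_def)
  next
    case z: (Suc w)
    then have "prod_encode (code_s a, code_j a) = w" by (simp add: code_s_def code_j_def)
    moreover have "prod_encode (code_x a, code_z a) = b" using Suc by (simp add: code_x_def code_z_def)
    ultimately show ?thesis using Suc z by (simp add: vert_decode_def)
  qed
qed (simp add: vert_decode_def)

lemma bij_vert_encode: "bij vert_encode"
  by (rule bij_betw_byWitness[of _ vert_decode]) (auto simp: vert_encode_inverse vert_decode_inverse)

definition graph_of :: "(nat \<Rightarrow> nat \<Rightarrow> nat) \<Rightarrow> nat pair_pre_digraph" where
  "graph_of c = \<lparr>pverts = UNIV, parcs = {(a, b). (vert_decode a, vert_decode b) \<in> edges c}\<rparr>"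

lemma copy_graph_of: "copy c vert_encode (graph_of c)"
  by (simp add: copy_def graph_of_def bij_vert_encode vert_encode_inverse)

lemma recursive_computable2:
  "computable2 c \<Longrightarrow> recursive k A \<Longrightarrow> recursive k B \<Longrightarrow> recursive k (\<lambda>xs. c (A xs) (B xs))"
  using recursive_comp2 computable2_iff_recursive by blast

definition code_arc :: "(nat \<Rightarrow> nat \<Rightarrow> nat) \<Rightarrow> nat \<Rightarrow> nat \<Rightarrow> bool" where
  "code_arc c a b \<longleftrightarrow> b \<noteq> 0 \<and>
    (a = 0 \<and> code_z b \<noteq> 0 \<and> code_j b = 0 \<or>
     a \<noteq> 0 \<and> code_z a \<noteq> 0 \<and> code_x a = code_x b \<and>
      (code_z b \<noteq> 0 \<and> code_s a = code_s b \<and> code_j b = Suc (code_j a) \<or>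
       code_z b = 0 \<and> c (code_x a) (code_s a) = Suc (code_j a)))"

lemma arc_vert_decode: "arc c (vert_decode a) (vert_decode b) \<longleftrightarrow> code_arc c a b"
  by (auto simp: vert_decode_def code_arc_def)

lemma computable_graph_of:
  assumes "computable2 c" shows "computable_graph (graph_of c)"
proof -
  have "decidable 2 (\<lambda>xs. code_arc c (xs ! 0) (xs ! 1) \<or> code_arc c (xs ! 1) (xs ! 0))"
    unfolding code_arc_def
    by (intro recursive_intros recursive_code recursive_computable2[OF assms]) auto
  then have "computable2 (\<lambda>u v. of_bool ((u, v) \<in> parcs (graph_of c)))"
    by (simp add: computable2_iff_recursive graph_of_def edges_def arc_vert_decode)
  then show ?thesis
    using copy_bidirected[OF copy_graph_of] by (simp add: computable_graph_def graph_of_def)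
qed

section \<open>Distances computed from codes and lowest joints\<close>

definition code_stretch :: "(nat \<Rightarrow> nat \<Rightarrow> nat) \<Rightarrow> nat \<Rightarrow> nat" where
  "code_stretch c a = stretch c (code_x a) (code_s a) (code_j a)"

definition code_attached :: "(nat \<Rightarrow> nat \<Rightarrow> nat) \<Rightarrow> nat \<Rightarrow> bool" where
  "code_attached c a \<longleftrightarrow> c (code_x a) (code_s a) \<noteq> 0"

definition code_root_dist :: "(nat \<Rightarrow> nat \<Rightarrow> nat) \<Rightarrow> nat \<Rightarrow> nat \<Rightarrow> nat" where
  "code_root_dist c m a = (if a = 0 then 0 else if code_z a = 0 then m + 2
    else if code_attached c a then min (Suc (code_j a)) (code_stretch c a + (m + 2)) else Suc (code_j a))"

text \<open>A bud counts as attached with stretch 0, which merges the bud cases of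
  \<open>vert_dist\<close> with that of two ray vertices. The last branch repeats the sum, so that
  the minimum is the sum itself.\<close>

definition code_dist :: "(nat \<Rightarrow> nat \<Rightarrow> nat) \<Rightarrow> nat \<Rightarrow> nat \<Rightarrow> nat \<Rightarrow> nat \<Rightarrow> nat" where
  "code_dist c m m' a b =
    (if a = 0 \<or> b = 0 \<or> code_x a \<noteq> code_x b then code_root_dist c m a + code_root_dist c m' b
     else if code_z a = 0 \<and> code_z b = 0 then 0
     else min (code_root_dist c m a + code_root_dist c m' b)
      (if code_z a \<noteq> 0 \<and> code_z b \<noteq> 0 \<and> code_s a = code_s b then gap (code_j a) (code_j b)
       else if (code_z a = 0 \<or> code_attached c a) \<and> (code_z b = 0 \<or> code_attached c b)
       then (if code_z a = 0 then 0 else code_stretch c a) + (if code_z b = 0 then 0 else code_stretch c b)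
       else code_root_dist c m a + code_root_dist c m' b))"

lemma root_dist_vert_decode: "root_dist c m (vert_decode a) = code_root_dist c m a"
  by (simp add: vert_decode_def code_root_dist_def code_attached_def code_stretch_def)

lemma vert_dist_vert_decode: "vert_dist c m m' (vert_decode a) (vert_decode b) = code_dist c m m' a b"
proof -
  consider (root) "a = 0 \<or> b = 0" | (bb) "a \<noteq> 0" "b \<noteq> 0" "code_z a = 0" "code_z b = 0"
    | (bn) "a \<noteq> 0" "b \<noteq> 0" "code_z a = 0" "code_z b \<noteq> 0"
    | (nb) "a \<noteq> 0" "b \<noteq> 0" "code_z a \<noteq> 0" "code_z b = 0"
    | (nn) "a \<noteq> 0" "b \<noteq> 0" "code_z a \<noteq> 0" "code_z b \<noteq> 0" by blast
  then show ?thesis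
  proof cases
    case root
    then have "vert_dist c m m' (vert_decode a) (vert_decode b) =
        root_dist c m (vert_decode a) + root_dist c m' (vert_decode b)"
      by (cases "vert_decode a"; cases "vert_decode b") (auto simp: vert_decode_def split: if_splits)
    then show ?thesis using root by (auto simp: root_dist_vert_decode code_dist_def)
  next
    case bb
    then show ?thesis by (simp add: vert_decode_def code_dist_def code_root_dist_def)
  next
    case bn
    then show ?thesis
      by (simp add: vert_decode_def code_dist_def code_root_dist_def code_attached_def code_stretch_def min.commute)
  next
    case nb
    then show ?thesis
      by (simp add: vert_decode_def code_dist_def code_root_dist_def code_attached_def code_stretch_def min.commute)
  next
    case nn
    then show ?thesis
      by (simp add: vert_decode_def code_dist_def code_root_dist_def code_attached_def code_stretch_def min.commute Let_def)
  qed
qed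

lemma recursive_code_dist:
  assumes c: "computable2 c" and "recursive k M" "recursive k M'" "recursive k A" "recursive k B"
  shows "recursive k (\<lambda>xs. code_dist c (M xs) (M' xs) (A xs) (B xs))"
proof -
  have st: "recursive k (\<lambda>xs. code_stretch c (F xs))" if "recursive k F" for F
    unfolding code_stretch_def stretch_def gap_def
    by (intro recursive_intros recursive_code recursive_computable2[OF c] that)
  have att: "decidable k (\<lambda>xs. code_attached c (F xs))" if "recursive k F" for F
    unfolding code_attached_def
    by (intro recursive_intros recursive_code recursive_computable2[OF c] that)
  have rd: "recursive k (\<lambda>xs. code_root_dist c (N xs) (F xs))" if "recursive k N" "recursive k F" for N F
    unfolding code_root_dist_def by (intro recursive_intros recursive_code st att that)
  show ?thesis
    unfolding code_dist_def gap_def by (intro recursive_intros recursive_code st att rd assms(2-))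
qed

lemma set_decode_less: "i \<in> set_decode t \<Longrightarrow> i < t"
  by (metis div_less even_zero le_less_trans less_exp mem_Collect_eq not_le set_decode_def)

lemma decidable_catalogue_shape:
  assumes "recursive k A" "recursive k B"
  shows "decidable k (\<lambda>xs. A xs \<in> catalogue_shape n (B xs))"
proof -
  have card: "card (set_decode t) = (\<Sum>i<t. of_bool (i \<in> set_decode t))" for t
  proof -
    have "{..<t} \<inter> {i. i \<in> set_decode t} = set_decode t" using set_decode_less by auto
    then show ?thesis by (simp add: of_bool_def sum.If_cases)
  qed
  have "set_decode t \<noteq> {} \<longleftrightarrow> t \<noteq> 0" for t
    by (metis set_decode_inverse set_decode_zero set_encode_empty)
  then have "s \<in> catalogue_shape n x \<longleftrightarrow>
      (let t = fst (prod_decode x); ok = (t \<noteq> 0 \<and> (\<Sum>i<t. of_bool (i \<in> set_decode t)) \<le> Suc n)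
       in ok \<and> s \<in> set_decode t \<or> \<not> ok \<and> s = 0)" for s x
    by (auto simp: catalogue_shape_def admissible_def card Let_def)
  moreover have "decidable 2 (\<lambda>xs. let t = fst (prod_decode (xs ! 1));
       ok = (t \<noteq> 0 \<and> (\<Sum>i<t. of_bool (i \<in> set_decode t)) \<le> Suc n)
       in ok \<and> xs ! 0 \<in> set_decode t \<or> \<not> ok \<and> xs ! 0 = 0)"
    unfolding Let_def
    by (intro recursive_intros decidable_set_decode recursive_fst_prod_decode) auto
  ultimately have "decidable 2 (\<lambda>xs. xs ! 0 \<in> catalogue_shape n (xs ! 1))" by simp
  from recursive_comp2[OF this assms] show ?thesis .
qed

lemma computable2_catalogue: "computable2 (catalogue n)"
  unfolding computable2_iff_recursive catalogue_def
  by (intro recursive_intros decidable_catalogue_shape) auto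

lemma recursive_low_catalogue:
  assumes "recursive k A" shows "recursive k (\<lambda>xs. low (catalogue n) (A xs))"
proof -
  have "recursive 1 (\<lambda>xs. LEAST v. v \<in> catalogue_shape n (xs ! 0))"
    using admissible_catalogue_shape[of n]
    by (intro recursive_Mu decidable_catalogue_shape recursive_intros) (auto simp: admissible_def)
  then show ?thesis using recursive_comp1[OF _ assms] by (simp add: low_def shape_catalogue)
qed

lemma computable2_tracking:
  assumes "computable2 g" shows "computable2 (tracking g)"
  unfolding computable2_iff_recursive tracking_def
  by (intro recursive_intros recursive_computable2[OF assms]) auto

lemma computable2_interleave:
  assumes "computable2 c" "computable2 c'" shows "computable2 (interleave c c')"
proof -
  have "interleave c c' x s = (if even x then c (x div 2) s else c' (x div 2) s)" for x s
    by (simp add: interleave_def)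
  then show ?thesis
    unfolding computable2_iff_recursive
    by (simp only:) (intro recursive_intros decidable_even recursive_div2 recursive_computable2[OF assms(1)]
      recursive_computable2[OF assms(2)]; simp)
qed

section \<open>Oracle answers and the two reductions\<close>

text \<open>On the code of a restriction at most one summand survives. The bound \<open>u\<close>
  suffices: elements of \<open>set_decode u\<close> are below \<open>u\<close>, and so are the
  components of the pairs that they code.\<close>

definition lookup :: "nat \<Rightarrow> nat \<Rightarrow> nat" where
  "lookup u x = (\<Sum>y<u. y * of_bool (prod_encode (x, y) \<in> set_decode u))"

lemma recursive_lookup:
  assumes "recursive k A" "recursive k B" shows "recursive k (\<lambda>xs. lookup (A xs) (B xs))"
proof -
  have "recursive 2 (\<lambda>xs. lookup (xs ! 0) (xs ! 1))"
    unfolding lookup_def by (intro recursive_intros decidable_set_decode recursive_prod_encode) auto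
  from recursive_comp2[OF this assms] show ?thesis .
qed

lemma lookup_restriction_code:
  assumes "finite D" "x \<in> D" shows "lookup (restriction_code f D) x = f x"
proof -
  let ?u = "restriction_code f D"
  have mem: "prod_encode (x, y) \<in> set_decode ?u \<longleftrightarrow> y = f x" for y
    using assms by (auto simp: restriction_code_def)
  have "f x < ?u"
    using set_decode_less[of "prod_encode (x, f x)" ?u] mem[of "f x"] le_prod_encode_2[of "f x" x] by simp
  moreover have "lookup ?u x = (\<Sum>y<?u. if y = f x then y else 0)"
    unfolding lookup_def mem by (intro sum.cong) auto
  ultimately show ?thesis by simp
qed

lemma gadget_index_vert_decode: "gadget_index (vert_decode a) = code_x a"
proof -
  have "prod_decode 0 = (0, 0)"
    using prod_encode_inverse[of "(0, 0)"] by (simp add: prod_encode_def)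
  then show ?thesis by (simp add: gadget_index_def vert_decode_def code_x_def)
qed

lemma distance_function_graph_of:
  assumes "tame n c"
  shows "distance_function (graph_of c) (prod_encode (a, b)) =
    code_dist c (low c (code_x a)) (low c (code_x b)) a b"
proof -
  have "distance_function (graph_of c) (prod_encode (a, b)) = (LEAST l. route c UNIV (vert_decode a) (vert_decode b) l)"
    using distance_function_copy[OF copy_graph_of, of c "vert_decode a" "vert_decode b"]
    by (simp add: vert_decode_inverse)
  also have "\<dots> = vert_dist c (low c (code_x a)) (low c (code_x b)) (vert_decode a) (vert_decode b)"
    using is_least_Least[OF is_least_route[OF assms, of "vert_decode a" "vert_decode b"]]
    by (simp add: gadget_index_vert_decode)
  finally show ?thesis by (simp add: vert_dist_vert_decode)
qed

text \<open>The oracle enters a distance only through the lowest joints of the two gadgets involved,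
  one query each; for gadgets at odd positions the lowest joint is computed by \<open>h\<close>
  instead.\<close>

lemma btt_distance_function:
  assumes "computable2 c" "tame n c" "\<And>x. low c x = (if even x then f (x div 2) else h (x div 2))"
    and h: "recursive 1 (\<lambda>xs. h (xs ! 0))"
  shows "btt_reducible 2 (distance_function (graph_of c)) f"
proof -
  define L where "L z = code_x (fst (prod_decode z)) div 2" for z
  define R where "R z = code_x (snd (prod_decode z)) div 2" for z
  \<comment> \<open>For equal queries the sum would be \<open>2 ^ (L z + 1)\<close>, the index of a
    different set.\<close>
  define p where "p z = (if L z = R z then 2 ^ L z else 2 ^ L z + 2 ^ R z :: nat)" for z
  define bottom where "bottom u x = (if even x then lookup u (x div 2) else h (x div 2))" for u x
  define q where "q z u = code_dist c (bottom u (code_x (fst (prod_decode z)))) (bottom u (code_x (snd (prod_decode z))))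
     (fst (prod_decode z)) (snd (prod_decode z))" for z u
  have "p z = set_encode {L z, R z}" for z by (simp add: p_def set_encode_def)
  then have p: "set_decode (p z) = {L z, R z}" for z by (simp only: set_encode_inverse finite.intros)
  have "computable p"
    unfolding computable_iff_recursive p_def L_def R_def
    by (intro recursive_intros recursive_div2 recursive_code recursive_fst_prod_decode recursive_snd_prod_decode) auto
  moreover have "computable2 q"
    unfolding computable2_iff_recursive q_def bottom_def
    by (intro recursive_code_dist[OF assms(1)] recursive_intros recursive_div2 recursive_code decidable_even
      recursive_lookup recursive_comp1[OF h] recursive_fst_prod_decode recursive_snd_prod_decode) auto
  moreover have "card (set_decode (p z)) \<le> 2" for z
    unfolding p by (simp add: card_insert_if)
  moreover have "distance_function (graph_of c) z = q z (restriction_code f (set_decode (p z)))" for z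
  proof -
    have "lookup (restriction_code f (set_decode (p z))) x = f x" if "x \<in> {L z, R z}" for x
      using that by (intro lookup_restriction_code) (auto simp: p)
    then have "bottom (restriction_code f (set_decode (p z))) (code_x a) = low c (code_x a)"
      if "a \<in> {fst (prod_decode z), snd (prod_decode z)}" for a
      using that by (auto simp: bottom_def assms(3) L_def R_def)
    then show ?thesis
      using distance_function_graph_of[OF assms(2), of "fst (prod_decode z)" "snd (prod_decode z)"]
      by (simp add: q_def)
  qed
  ultimately show ?thesis unfolding btt_reducible_def by blast
qed

lemma btt_to_distance_function:
  assumes "tame n c" "\<And>x. low c (2 * x) = f x"
  shows "btt_reducible 1 f (distance_function (graph_of c))"
proof -
  \<comment> \<open>The pair of the root, coded by 0, and the bud of gadget \<open>2 * x\<close>,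
    whose distance is \<open>f x + 2\<close>.\<close>
  define P where "P x = prod_encode (0, Suc (prod_encode (2 * x, 0)))" for x
  have "recursive k (\<lambda>xs. P (A xs))" if "recursive k A" for k A
    unfolding P_def by (intro recursive_intros recursive_prod_encode that)
  note P = this
  have "computable (\<lambda>x. 2 ^ P x)"
    unfolding computable_iff_recursive by (intro recursive_intros P) auto
  moreover have "computable2 (\<lambda>x u. lookup u (P x) - 2)"
    unfolding computable2_iff_recursive by (intro recursive_intros recursive_lookup P) auto
  moreover have "card (set_decode (2 ^ P x)) \<le> 1" for x by (simp add: set_decode_pow2)
  moreover have "f x = lookup (restriction_code (distance_function (graph_of c)) (set_decode (2 ^ P x))) (P x) - 2" for x
  proof -
    have "distance_function (graph_of c) (P x) = f x + 2"
      using distance_function_copy[OF copy_graph_of, of c Root "Bud (2 * x)"] assms(2)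
        is_least_Least[OF is_least_route[OF assms(1), of Root "Bud (2 * x)"]]
      by (simp add: P_def gadget_index_def)
    then show ?thesis by (simp add: set_decode_pow2 lookup_restriction_code)
  qed
  ultimately show ?thesis unfolding btt_reducible_def by blast
qed

lemma intrinsically_approximable_graph_of:
  assumes "tame n c"
  shows "intrinsically_approximable_from_above (2 * n) (graph_of c)"
  unfolding intrinsically_approximable_from_above_def
proof (intro allI impI, elim conjE)
  fix H assume H: "computable_graph H" "digraph_iso (with_proj (graph_of c)) (with_proj H)"
  obtain \<psi> where \<psi>: "copy c \<psi> H" using digraph_iso_copy[OF copy_graph_of H(2,1)] .
  show "approximable_from_above (2 * n) (distance_function H)"
  proof (rule copy_approximable[OF \<psi> H(1)])
    show "\<exists>k. route c UNIV u v k" for u v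
      using is_least_route[OF assms] by (auto simp: is_least_def)
  qed (use assms in \<open>auto simp: tame_def\<close>)
qed

theorem theorem5p4:
  fixes n :: nat
  shows "\<exists>G :: nat pair_pre_digraph.
    computable_graph G \<and> Digraph_Component.connected (with_proj G) \<and>
    intrinsically_approximable_from_above (2 * n) G \<and>
    (\<forall>f :: nat \<Rightarrow> nat. approximable_from_above n f \<longrightarrow>
      (\<exists>H :: nat pair_pre_digraph.
        computable_graph H \<and> digraph_iso (with_proj G) (with_proj H) \<and>
        btt_reducible 2 (distance_function H) f \<and>
        btt_reducible 1 f (distance_function H)))"
proof (rule exI, intro conjI allI impI)
  let ?G = "graph_of (catalogue n)"
  show "computable_graph ?G" by (rule computable_graph_of[OF computable2_catalogue])
  show "Digraph_Component.connected (with_proj ?G)"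
    using is_least_route[OF tame_catalogue]
    by (intro copy_connected[OF copy_graph_of]) (auto simp: is_least_def)
  show "intrinsically_approximable_from_above (2 * n) ?G"
    by (rule intrinsically_approximable_graph_of[OF tame_catalogue])
  fix f :: "nat \<Rightarrow> nat" assume "approximable_from_above n f"
  then obtain g where g: "computable2 g" "\<And>x. g x \<longlonglongrightarrow> f x" "\<And>x s. g x (Suc s) \<le> g x s"
    "\<And>x. finite (changes (g x)) \<and> card (changes (g x)) \<le> n"
    unfolding approximable_from_above_def changes_def by auto
  define c where "c = interleave (tracking g) (catalogue n)"
  have comp: "computable2 c"
    unfolding c_def by (intro computable2_interleave computable2_tracking computable2_catalogue g)
  have universal: "universal n c"
    unfolding c_def by (intro universal_interleave tame_tracking universal_catalogue g)
  then have tame: "tame n c" by (simp add: universal_def)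
  have low: "low c x = (if even x then f (x div 2) else low (catalogue n) (x div 2))" for x
    unfolding c_def low_interleave using low_tracking[of g _ f] g(2,3) by simp
  obtain \<theta> where "bij \<theta>" "\<And>u v. (u, v) \<in> edges (catalogue n) \<longleftrightarrow> (\<theta> u, \<theta> v) \<in> edges c"
    using universal_iso[OF universal_catalogue universal] by blast
  \<comment> \<open>The isomorphism turns \<open>graph_of c\<close> into another labelling of the
    catalogue's own graph.\<close>
  from copy_relabel[OF copy_graph_of this]
  have "digraph_iso (with_proj ?G) (with_proj (graph_of c))"
    by (rule copy_digraph_iso[OF copy_graph_of])
  moreover have "computable_graph (graph_of c)" using comp by (rule computable_graph_of)
  moreover have "btt_reducible 2 (distance_function (graph_of c)) f"
    by (rule btt_distance_function[OF comp tame low]) (intro recursive_low_catalogue recursive_nth, simp)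
  moreover have "btt_reducible 1 f (distance_function (graph_of c))"
    by (rule btt_to_distance_function[OF tame]) (simp add: low)
  ultimately show "\<exists>H. computable_graph H \<and> digraph_iso (with_proj ?G) (with_proj H) \<and>
      btt_reducible 2 (distance_function H) f \<and> btt_reducible 1 f (distance_function H)"
    by blast
qed

end
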